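(* Let $d\ge2$, $m\ge1$, $\omega\in\Omega_{d,m}$, let $G_\omega$ be the corresponding spinal group with spinal generating set $S$, and let $\xi\in X^{\mathbb{N}}$. Partition $X^{\mathbb{N}}$ into $E_2=X^*\{0,d-1\}^{\mathbb{N}}\setminus\operatorname{Cof}((d-1)^{\mathbb{N}})$ and $E_1=X^{\mathbb{N}}\setminus E_2$. Then the Schreier graph $\Gamma_\xi$ is $2$-ended if and only if $\xi\in E_2$, and $\Gamma_\xi$ is $1$-ended if and only if $\xi\in E_1$.
   Context: Let $X=\{0,\dots,d-1\}$ with addition modulo $d$. $T_d$ is the $d$-ary rooted tree with vertex set $X^*$ (finite words); its boundary is $X^{\mathbb{N}}$ (infinite words), on which automorphisms of $T_d$ act via prefixes. Let $a(v_0v_1\dots)=(v_0+1)v_1\dots$ and $A=\langle a\rangle\cong\mathbb{Z}/d\mathbb{Z}$. Let $B=(\mathbb{Z}/d\mathbb{Z})^m$ and let $\operatorname{Epi}(B,A)$ be the set of surjective homomorphisms $B\to A$. $\Omega_{d,m}$ is the set of sequences $\omega=(\omega_n)_{n\ge0}$ in $\operatorname{Epi}(B,A)$ with $\bigcap_{j\ge i}\operatorname{Ker}(\omega_j)=1$ for all $i\ge0$. For $b\in B$, $b_\omega\in\operatorname{Aut}(T_d)$ sends a word of the form $(d-1)^r0v_{r+1}v_{r+2}\dots$ ($r\ge0$) to $(d-1)^r0\,\omega_r(b)(v_{r+1})\,v_{r+2}\dots$ and fixes all other words. The map $b\mapsto b_\omega$ is an injective homomorphism, and $B$ is identified with its image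 $B_\omega$. The spinal group is $G_\omega=\langle A,B_\omega\rangle$ and its spinal generating set is $S=(A\cup B_\omega)\setminus\{1\}$. The Schreier graph $\Gamma_\xi$ has as vertex set the orbit $G_\omega\cdot\xi$ and a directed edge labeled $s$ from $y$ to $s(y)$ for all $y\in G_\omega\cdot\xi$, $s\in S$. $\operatorname{Cof}(\xi)$ is the set of infinite words differing from $\xi$ in finitely many letters; $(d-1)^{\mathbb{N}}$ is the constant word. $X^*\{0,d-1\}^{\mathbb{N}}$ is the set of words $w\zeta$ with $w\in X^*$, $\zeta\in\{0,d-1\}^{\mathbb{N}}$. A graph $\Gamma$ is $k$-ended if, for every vertex $v$, $\Gamma\setminus\{v\}$ has at most $k$ infinite connected components, and $k$ is minimal with this property; orientation, labels and root play no role. *)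

theory Defs
  imports
    "HOL-Algebra.Bij"
    "HOL-Algebra.Generated_Groups"
    "HOL-Algebra.Product_Groups"
    "HOL-Library.Omega_Words_Fun"
    "Graph_Theory.Digraph_Component"
begin

section \<open>The rooted tree, its boundary and its automorphism group\<close>

text \<open>
  The letters are \<open>0, \<dots>, d - 1\<close>. Finite words are lists, and \<open>lists {..<d}\<close> is the vertex set
  of the tree. Infinite words are functions on the naturals, as in Omega-Words.
\<close>

type_synonym tree_map = "nat list \<Rightarrow> nat list"

definition tree_adj :: "nat list \<Rightarrow> nat list \<Rightarrow> bool" where
  "tree_adj u v \<longleftrightarrow> (\<exists>x. v = u @ [x] \<or> u = v @ [x])"

definition tree_aut :: "nat \<Rightarrow> tree_map monoid" where
  "tree_aut d = (BijGroup (lists {..<d}))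
     \<lparr>carrier := {g \<in> Bij (lists {..<d}). g [] = [] \<and>
        (\<forall>u \<in> lists {..<d}. \<forall>v \<in> lists {..<d}. tree_adj (g u) (g v) \<longleftrightarrow> tree_adj u v)}\<rparr>"

definition boundary :: "nat \<Rightarrow> nat word set" where
  "boundary d = {\<xi>. range \<xi> \<subseteq> {..<d}}"

definition boundary_act :: "tree_map \<Rightarrow> nat word \<Rightarrow> nat word" where
  "boundary_act g \<xi> = (\<lambda>n. g (prefix (Suc n) \<xi>) ! n)"

section \<open>Spinal groups\<close>

definition rooted_a :: "nat \<Rightarrow> tree_map" where
  "rooted_a d = (\<lambda>u \<in> lists {..<d}. case u of [] \<Rightarrow> [] | x # w \<Rightarrow> ((x + 1) mod d) # w)"

definition group_A :: "nat \<Rightarrow> tree_map monoid" where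
  "group_A d = (tree_aut d)\<lparr>carrier := generate (tree_aut d) {rooted_a d}\<rparr>"

definition group_B :: "nat \<Rightarrow> nat \<Rightarrow> (nat \<Rightarrow> int) monoid" where
  "group_B d m = product_group {..<m} (\<lambda>_. integer_mod_group d)"

definition Omega :: "nat \<Rightarrow> nat \<Rightarrow> (nat \<Rightarrow> (nat \<Rightarrow> int) \<Rightarrow> tree_map) set" where
  "Omega d m = {\<omega>. (\<forall>n. \<omega> n \<in> epi (group_B d m) (group_A d)) \<and>
     (\<forall>i. (\<Inter>j\<in>{i..}. kernel (group_B d m) (group_A d) (\<omega> j)) = {\<one>\<^bsub>group_B d m\<^esub>})}"

text \<open>
  Below, \<open>r\<close> is the length of the longest prefix of \<open>u\<close> of the form \<open>(d - 1)\<^sup>r\<close>. An element of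
  \<open>A\<close> acts on a letter \<open>x\<close> through its action on the one-letter word \<open>[x]\<close>.
\<close>

definition spinal_elt ::
  "nat \<Rightarrow> (nat \<Rightarrow> (nat \<Rightarrow> int) \<Rightarrow> tree_map) \<Rightarrow> (nat \<Rightarrow> int) \<Rightarrow> tree_map" where
  "spinal_elt d \<omega> b = (\<lambda>u \<in> lists {..<d}.
     let r = length (takeWhile (\<lambda>x. x = d - 1) u) in
     if Suc r < length u \<and> u ! r = 0 then u[Suc r := hd (\<omega> r b [u ! Suc r])] else u)"

lemma spinal_elt_spine:
  assumes "d \<ge> 2" "x < d" "w \<in> lists {..<d}"
  shows "spinal_elt d \<omega> b (replicate r (d - 1) @ [0, x] @ w) =
    replicate r (d - 1) @ [0, hd (\<omega> r b [x])] @ w"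
proof -
  have "length (takeWhile (\<lambda>x. x = d - 1) (replicate r (d - 1) @ [0, x] @ w)) = r"
    using assms(1) by (induction r) auto
  moreover have "replicate r (d - 1) @ [0, x] @ w \<in> lists {..<d}"
    using assms by (auto simp: in_lists_conv_set)
  ultimately show ?thesis
    by (simp add: spinal_elt_def nth_append list_update_append)
qed

lemma spinal_elt_other:
  assumes "u \<in> lists {..<d}" "\<nexists>r x w. u = replicate r (d - 1) @ [0, x] @ w"
  shows "spinal_elt d \<omega> b u = u"
proof -
  define r where "r = length (takeWhile (\<lambda>x. x = d - 1) u)"
  have "takeWhile (\<lambda>x. x = d - 1) u = replicate r (d - 1)"
    unfolding r_def by (metis (mono_tags, lifting) replicate_eqI set_takeWhileD)
  moreover have "drop r u = [0, u ! Suc r] @ drop (Suc (Suc r)) u" if "Suc r < length u" "u ! r = 0"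
    using that by (simp add: Cons_nth_drop_Suc[symmetric])
  moreover have "u = takeWhile (\<lambda>x. x = d - 1) u @ drop r u"
    unfolding r_def by (simp add: dropWhile_eq_drop[symmetric])
  ultimately have "\<not> (Suc r < length u \<and> u ! r = 0)"
    using assms(2) by metis
  then show ?thesis
    using assms(1) by (auto simp: spinal_elt_def r_def)
qed

definition group_B_omega ::
  "nat \<Rightarrow> nat \<Rightarrow> (nat \<Rightarrow> (nat \<Rightarrow> int) \<Rightarrow> tree_map) \<Rightarrow> tree_map set" where
  "group_B_omega d m \<omega> = spinal_elt d \<omega> ` carrier (group_B d m)"

definition spinal_group ::
  "nat \<Rightarrow> nat \<Rightarrow> (nat \<Rightarrow> (nat \<Rightarrow> int) \<Rightarrow> tree_map) \<Rightarrow> tree_map set" where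
  "spinal_group d m \<omega> = generate (tree_aut d) (carrier (group_A d) \<union> group_B_omega d m \<omega>)"

definition spinal_gens ::
  "nat \<Rightarrow> nat \<Rightarrow> (nat \<Rightarrow> (nat \<Rightarrow> int) \<Rightarrow> tree_map) \<Rightarrow> tree_map set" where
  "spinal_gens d m \<omega> = (carrier (group_A d) \<union> group_B_omega d m \<omega>) - {\<one>\<^bsub>tree_aut d\<^esub>}"

section \<open>Schreier graphs and ends\<close>

text \<open>The arc \<open>(y, s)\<close> runs from \<open>y\<close> to \<open>s(y)\<close> and carries the label \<open>s\<close>.\<close>

definition schreier_graph ::
  "tree_map set \<Rightarrow> tree_map set \<Rightarrow> nat word \<Rightarrow>
   (nat word, nat word \<times> tree_map) pre_digraph" where
  "schreier_graph G S \<xi> =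
    (let orb = (\<lambda>g. boundary_act g \<xi>) ` G in
     \<lparr>verts = orb, arcs = orb \<times> S, tail = fst, head = (\<lambda>(y, s). boundary_act s y)\<rparr>)"

text \<open>
  Connected components disregard orientation: they are the strongly connected components of the
  symmetrized graph, given by their vertex sets.
\<close>

definition inf_components_del :: "('v, 'e) pre_digraph \<Rightarrow> 'v \<Rightarrow> 'v set set" where
  "inf_components_del \<Gamma> v =
     {C \<in> pre_digraph.sccs_verts (with_proj (mk_symmetric (pre_digraph.del_vert \<Gamma> v))). infinite C}"

definition at_most_ended :: "nat \<Rightarrow> ('v, 'e) pre_digraph \<Rightarrow> bool" where
  "at_most_ended k \<Gamma> \<longleftrightarrow>
     (\<forall>v \<in> verts \<Gamma>. finite (inf_components_del \<Gamma> v) \<and> card (inf_components_del \<Gamma> v) \<le> k)"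

definition ended :: "nat \<Rightarrow> ('v, 'e) pre_digraph \<Rightarrow> bool" where
  "ended k \<Gamma> \<longleftrightarrow> at_most_ended k \<Gamma> \<and> (\<forall>j<k. \<not> at_most_ended j \<Gamma>)"

section \<open>The partition of the boundary\<close>

definition Cof :: "nat \<Rightarrow> nat word \<Rightarrow> nat word set" where
  "Cof d \<xi> = {\<eta> \<in> boundary d. finite {n. \<eta> n \<noteq> \<xi> n}}"

definition E2 :: "nat \<Rightarrow> nat word set" where
  "E2 d = {w \<frown> \<zeta> |w \<zeta>. w \<in> lists {..<d} \<and> range \<zeta> \<subseteq> {0, d - 1}} - Cof d (\<lambda>_. d - 1)"

definition E1 :: "nat \<Rightarrow> nat word set" where
  "E1 d = boundary d - E2 d"

lemma boundary_partition:
  assumes "d \<ge> 2"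
  shows "E1 d \<union> E2 d = boundary d" and "E1 d \<inter> E2 d = {}"
proof -
  have "E2 d \<subseteq> boundary d"
  proof
    fix \<eta> assume "\<eta> \<in> E2 d"
    then obtain w \<zeta> where eta: "\<eta> = w \<frown> \<zeta>" "w \<in> lists {..<d}" "range \<zeta> \<subseteq> {0, d - 1}"
      unfolding E2_def by blast
    have "range \<eta> = set w \<union> range \<zeta>" unfolding eta(1) by (rule range_conc)
    moreover have "set w \<subseteq> {..<d}" using eta(2) by (simp add: lists_eq_set)
    moreover have "{0, d - 1} \<subseteq> {..<d}" using assms by auto
    ultimately show "\<eta> \<in> boundary d"
      unfolding boundary_def using eta(3) by blast
  qed
  then show "E1 d \<union> E2 d = boundary d"
    by (auto simp: E1_def)
qed (auto simp: E1_def)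

end

theory Submission
  imports Defs
begin

text \<open>
  Since every \<open>\<omega>\<^sub>r\<close> is onto \<open>A\<close>, the Schreier graph is, up to loops, labels and multiplicities,
  independent of \<open>\<omega>\<close>: its vertices are the words cofinal to \<open>\<xi>\<close>, and two of them are adjacent iff
  they differ in the first letter only, or in one letter preceded by \<open>(d - 1)\<^sup>r 0\<close> only. It is the
  increasing union of the finite blocks of words that agree with \<open>\<xi>\<close> from position \<open>n\<close> on, and
  such a block can be left through at most two gates: \<open>(d - 1)\<^sup>n\<^sup>-\<^sup>1 0 \<xi>\<^sub>n \<xi>\<^sub>n\<^sub>+\<^sub>1 \<dots>\<close>, and
  \<open>(d - 1)\<^sup>n \<xi>\<^sub>n \<xi>\<^sub>n\<^sub>+\<^sub>1 \<dots>\<close> if the tail of \<open>\<xi>\<close> starts with some \<open>(d - 1)\<^sup>r 0\<close>. An infinite component of the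
  graph minus a vertex contains a gate of every large block, so there are at most two such
  components, and only one if the second gate is closed for infinitely many \<open>n\<close>, which is the case
  exactly on \<open>E\<^sub>1\<close>. On \<open>E\<^sub>2\<close> the first gate of a large block is a cut vertex with two infinite sides.
\<close>

section \<open>Components after deleting a vertex\<close>

text \<open>Links arcs to a plain relation up to loops: \<open>R_arc\<close> asks for an arc only
  when \<open>y \<noteq> z\<close>, because \<open>R\<close> may be reflexive at a vertex without a
  loop and loops do not influence components.\<close>

locale adjacency =
  fixes \<Gamma> :: "('v, 'e) pre_digraph" and R :: "'v \<Rightarrow> 'v \<Rightarrow> bool"
  assumes arc_R: "e \<in> arcs \<Gamma> \<Longrightarrow> R (tail \<Gamma> e) (head \<Gamma> e)"
    and R_arc: "\<lbrakk>y \<in> verts \<Gamma>; z \<in> verts \<Gamma>; R y z; y \<noteq> z\<rbrakk> \<Longrightarrow> \<exists>e\<in>arcs \<Gamma>. tail \<Gamma> e = y \<and> head \<Gamma> e = z"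
    and R_sym: "\<lbrakk>y \<in> verts \<Gamma>; z \<in> verts \<Gamma>; R y z\<rbrakk> \<Longrightarrow> R z y"
begin

text \<open>Every point of a path counted by \<open>rtrancl_on\<close> lies in \<open>W\<close>, so
  \<open>W = verts \<Gamma> - {v}\<close> expresses connection after deleting
  \<open>v\<close>.\<close>

definition conn :: "'v set \<Rightarrow> 'v \<Rightarrow> 'v \<Rightarrow> bool" where
  "conn W x y \<longleftrightarrow> (x, y) \<in> rtrancl_on W {(a, b). R a b}"

lemma conn_in: "conn W x y \<Longrightarrow> x \<in> W \<and> y \<in> W"
  unfolding conn_def by (meson in_rtrancl_on_in_F)

lemma conn_refl: "x \<in> W \<Longrightarrow> conn W x x"
  unfolding conn_def by simp

lemma conn_trans: "conn W x y \<Longrightarrow> conn W y z \<Longrightarrow> conn W x z"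
  unfolding conn_def by (rule rtrancl_on_trans)

lemma conn_step: "conn W x y \<Longrightarrow> R y z \<Longrightarrow> z \<in> W \<Longrightarrow> conn W x z"
  unfolding conn_def by (auto intro: rtrancl_on_into_rtrancl_on)

lemma conn_induct [consumes 1, case_names base step]:
  assumes "conn W x y" "x \<in> W \<Longrightarrow> P x"
    "\<And>y z. \<lbrakk>conn W x y; R y z; y \<in> W; z \<in> W; P y\<rbrakk> \<Longrightarrow> P z"
  shows "P y"
  using assms(1) unfolding conn_def
  by (induct rule: rtrancl_on_induct) (use assms(2,3) in \<open>auto simp: conn_def\<close>)

lemma conn_sym:
  assumes "conn W x y" "W \<subseteq> verts \<Gamma>" shows "conn W y x"
  using assms(1)
proof (induct rule: conn_induct)
  case (step y z)
  then have "conn W z y"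
    using assms(2) by (meson R_sym conn_refl conn_step subsetD)
  then show ?case using step conn_trans by blast
qed (rule conn_refl)

text \<open>Reversed arcs of the symmetrization are absorbed by the symmetry of \<open>R\<close>,
  and reflexive \<open>R\<close>-steps by staying at the same vertex.\<close>

lemma reachable_del_vert:
  "x \<rightarrow>\<^sup>*\<^bsub>with_proj (mk_symmetric (pre_digraph.del_vert \<Gamma> v))\<^esub> y \<longleftrightarrow> conn (verts \<Gamma> - {v}) x y"
    (is "?l \<longleftrightarrow> ?r")
proof -
  let ?E = "arcs_ends (with_proj (mk_symmetric (pre_digraph.del_vert \<Gamma> v)))"
  have E: "?E = (\<Union>e\<in>{e \<in> arcs \<Gamma>. tail \<Gamma> e \<noteq> v \<and> head \<Gamma> e \<noteq> v}.
      {(tail \<Gamma> e, head \<Gamma> e), (head \<Gamma> e, tail \<Gamma> e)})"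
    by (simp add: parcs_mk_symmetric pre_digraph.del_vert_def)
  have l: "?l \<longleftrightarrow> (x, y) \<in> rtrancl_on (verts \<Gamma> - {v}) ?E"
    by (simp add: reachable_def pre_digraph.del_vert_def)
  show ?thesis
  proof
    assume ?l
    then have "(x, y) \<in> rtrancl_on (verts \<Gamma> - {v}) ?E" by (simp only: l)
    then show ?r
    proof (induct rule: rtrancl_on_induct)
      case (step y z)
      from step(2) obtain e where "e \<in> arcs \<Gamma>"
          "tail \<Gamma> e = y \<and> head \<Gamma> e = z \<or> tail \<Gamma> e = z \<and> head \<Gamma> e = y"
        unfolding E by blast
      then have "R y z" using arc_R[of e] R_sym[of z y] step(3,4) by auto
      then show ?case using step conn_step by blast
    qed (rule conn_refl)
  next
    assume ?r
    then have "(x, y) \<in> rtrancl_on (verts \<Gamma> - {v}) ?E"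
    proof (induct rule: conn_induct)
      case (step y z)
      show ?case
      proof (cases "y = z")
        case False
        then obtain e where "e \<in> arcs \<Gamma>" "tail \<Gamma> e = y" "head \<Gamma> e = z"
          using step R_arc by blast
        then have "(y, z) \<in> ?E" using step(3,4) unfolding E by blast
        then show ?thesis using step by (meson rtrancl_on_into_rtrancl_on)
      qed (use step in simp)
    qed simp
    then show ?l by (simp only: l)
  qed
qed

text \<open>Connection is symmetric on vertices, so the maximal mutually reachable sets are
  equivalence classes, each generated by any of its points.\<close>

lemma inf_components_del_iff:
  "C \<in> inf_components_del \<Gamma> v \<longleftrightarrow>
    infinite C \<and> (\<exists>x \<in> verts \<Gamma> - {v}. C = {y. conn (verts \<Gamma> - {v}) x y})" (is "?l \<longleftrightarrow> ?r")
proof -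
  let ?c = "conn (verts \<Gamma> - {v})"
  have l: "?l \<longleftrightarrow> infinite C \<and> C \<noteq> {} \<and> (\<forall>u \<in> C. \<forall>w \<in> C. ?c u w) \<and>
      (\<forall>u \<in> C. \<forall>w. w \<notin> C \<longrightarrow> \<not> ?c u w \<or> \<not> ?c w u)"
    unfolding inf_components_del_def pre_digraph.sccs_verts_def reachable_del_vert by auto
  have sym: "?c a b \<Longrightarrow> ?c b a" for a b by (rule conn_sym) auto
  show ?thesis
  proof
    assume ?l
    then have C: "infinite C" "C \<noteq> {}" "\<forall>u \<in> C. \<forall>w \<in> C. ?c u w" "\<forall>u \<in> C. \<forall>w. w \<notin> C \<longrightarrow> \<not> ?c u w"
      using l sym by blast+
    then obtain x where "x \<in> C" by blast
    then have "C = {y. ?c x y}" "x \<in> verts \<Gamma> - {v}" using C conn_in by blast+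
    then show ?r using C by blast
  next
    assume ?r
    then obtain x where x: "infinite C" "x \<in> verts \<Gamma> - {v}" "C = {y. ?c x y}" by blast
    have "?c u w" if "u \<in> C" "w \<in> C" for u w
      using that x(3) sym conn_trans by blast
    moreover have "\<not> ?c u w" if "u \<in> C" "w \<notin> C" for u w
      using that x(3) conn_trans by blast
    ultimately show ?l using l x(1) infinite_imp_nonempty by blast
  qed
qed

lemma conn_exit:
  assumes "conn W x z" "x \<in> F" "z \<notin> F"
  obtains y w where "conn W x y" "y \<in> F" "w \<in> W - F" "R y w"
proof -
  have "z \<in> F \<or> (\<exists>y w. conn W x y \<and> y \<in> F \<and> w \<in> W - F \<and> R y w)"
    using assms(1) by (induct rule: conn_induct) (use assms(2) in auto)
  then show ?thesis using assms(3) that by blast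
qed

text \<open>An infinite component that meets the finite set \<open>F'\<close> must leave it, hence
  contains a point of the small set \<open>P\<close>. Distinct components are disjoint, so they use
  distinct points of \<open>P\<close>.\<close>

lemma at_most_endedI:
  assumes "\<And>F. finite F \<Longrightarrow> F \<subseteq> verts \<Gamma> \<Longrightarrow>
    \<exists>F' P. F \<subseteq> F' \<and> finite F' \<and> finite P \<and> card P \<le> k \<and>
      (\<forall>y \<in> F'. \<forall>z \<in> verts \<Gamma> - F'. R y z \<longrightarrow> y \<in> P)"
  shows "at_most_ended k \<Gamma>"
  unfolding at_most_ended_def
proof
  fix v
  let ?I = "inf_components_del \<Gamma> v"
  let ?c = "conn (verts \<Gamma> - {v})"
  have "finite ?I \<and> card ?I \<le> k"
  \<comment> \<open>Bounding all finite subfamilies also yields finiteness of the whole family, and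
    a finite subfamily has its representatives in one finite set.\<close>
  proof (rule finite_if_finite_subsets_card_bdd)
    fix T assume T: "T \<subseteq> ?I" "finite T"
    have "\<forall>C\<in>T. \<exists>x. infinite C \<and> x \<in> verts \<Gamma> - {v} \<and> C = {y. ?c x y}"
      using T inf_components_del_iff by blast
    then obtain x where x: "\<And>C. C \<in> T \<Longrightarrow> infinite C \<and> x C \<in> verts \<Gamma> - {v} \<and> C = {y. ?c (x C) y}"
      by metis
    have "finite (x ` T)" "x ` T \<subseteq> verts \<Gamma>" using T x by auto
    then obtain F P where F: "x ` T \<subseteq> F" "finite F" "finite P" "card P \<le> k"
        "\<And>y z. y \<in> F \<Longrightarrow> z \<in> verts \<Gamma> - F \<Longrightarrow> R y z \<Longrightarrow> y \<in> P"
      using assms by metis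
    have "\<exists>y. y \<in> C \<and> y \<in> P" if "C \<in> T" for C
    proof -
      have C: "infinite C" "C = {y. ?c (x C) y}" using x that by auto
      then obtain z where z: "z \<in> C" "z \<notin> F" using F(2) by (meson finite_subset subsetI)
      have "?c (x C) z" using z(1) C(2) by blast
      moreover have "x C \<in> F" using F(1) that by blast
      ultimately obtain y w where "?c (x C) y" "y \<in> F" "w \<in> verts \<Gamma> - {v} - F" "R y w"
        using z(2) by (rule conn_exit)
      then show ?thesis using C(2) F(5) by blast
    qed
    then obtain f where f: "\<And>C. C \<in> T \<Longrightarrow> f C \<in> C \<and> f C \<in> P" by metis
    have "inj_on f T"
    proof (rule inj_onI)
      fix C D assume CD: "C \<in> T" "D \<in> T" "f C = f D"
      have "?c (x C) (f C)" using x[OF CD(1)] f[OF CD(1)] by blast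
      moreover have "?c (x D) (f C)" using x[OF CD(2)] f[OF CD(2)] CD(3) by auto
      moreover have "?c a b \<Longrightarrow> ?c b a" for a b by (rule conn_sym) auto
      ultimately have "?c (x C) y \<longleftrightarrow> ?c (x D) y" for y using conn_trans by meson
      then show "C = D" using x CD(1,2) by blast
    qed
    then have "card T \<le> card P" using f F(3) by (intro card_inj_on_le[of f]) auto
    then show "card T \<le> k" using F(4) by linarith
  qed
  then show "finite ?I \<and> card ?I \<le> k" .
qed

text \<open>Every point of \<open>D\<close> is joined within \<open>D\<close> to one of the finitely many neighbours of \<open>v\<close>.\<close>

lemma inf_component_in_closed_set:
  assumes "v \<in> verts \<Gamma>" "\<And>x. x \<in> verts \<Gamma> \<Longrightarrow> conn (verts \<Gamma>) x v"
    "finite {w \<in> verts \<Gamma>. R v w}" "D \<subseteq> verts \<Gamma> - {v}" "infinite D"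
    "\<And>y z. \<lbrakk>y \<in> D; z \<in> verts \<Gamma> - {v}; R y z\<rbrakk> \<Longrightarrow> z \<in> D"
  obtains C where "C \<in> inf_components_del \<Gamma> v" "C \<subseteq> D"
proof -
  let ?c = "conn (verts \<Gamma> - {v})"
  let ?N = "{w \<in> D. R v w}"
  have closed: "y \<in> D" if "?c x y" "x \<in> D" for x y
    using that(1) by (induct rule: conn_induct) (use assms(6) that(2) in auto)
  have "\<exists>w\<in>?N. x \<in> {y. ?c w y}" if x: "x \<in> D" for x
  proof -
    have x': "x \<in> verts \<Gamma> - {v}" using assms(4) x by blast
    then have xv: "conn (verts \<Gamma>) x v" using assms(2)[of x] by simp
    \<comment> \<open>Along a path towards \<open>v\<close>, either \<open>v\<close> has been
      avoided so far or a neighbour of \<open>v\<close> inside \<open>D\<close> has already been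
      met; at \<open>t = v\<close> only the second alternative remains.\<close>
    have "?c x t \<or> (\<exists>w\<in>?N. ?c x w)" if "conn (verts \<Gamma>) x t" for t
      using that
    proof (induct rule: conn_induct)
      case base
      then show ?case using conn_refl[OF x'] by simp
    next
      case (step y z)
      show ?case
      proof (cases "\<exists>w\<in>?N. ?c x w")
        case False
        then have y: "?c x y" using step(5) by blast
        then have "y \<in> D" using closed x by simp
        show ?thesis
        proof (cases "z = v")
          case True
          then have "y \<in> ?N" using \<open>y \<in> D\<close> step R_sym[of y v] by simp
          then show ?thesis using y by auto
        next
          case False
          then show ?thesis using step(4) conn_step[OF y step(2)] by simp
        qed
      qed simp
    qed
    from this[OF xv] have "?c x v \<or> (\<exists>w\<in>?N. ?c x w)" .
    moreover have "\<not> ?c x v" using conn_in[of "verts \<Gamma> - {v}" x v] by blast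
    ultimately obtain w where "w \<in> ?N" "?c x w" by auto
    then show ?thesis using conn_sym[of "verts \<Gamma> - {v}" x w] by auto
  qed
  \<comment> \<open>Pigeonhole: finitely many components, one for each neighbour in
    \<open>?N\<close>, cover the infinite set \<open>D\<close>.\<close>
  then have "D \<subseteq> (\<Union>w\<in>?N. {y. ?c w y})" by blast
  then have "infinite (\<Union>w\<in>?N. {y. ?c w y})" using assms(5) finite_subset by blast
  moreover have "finite ?N" by (rule finite_subset[OF _ assms(3)]) (use assms(4) in auto)
  ultimately obtain w where w: "w \<in> ?N" "infinite {y. ?c w y}" by blast
  show ?thesis
  proof
    show "{y. ?c w y} \<in> inf_components_del \<Gamma> v"
      using w assms(4) inf_components_del_iff by blast
    show "{y. ?c w y} \<subseteq> D" using w closed by blast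
  qed
qed

end

section \<open>The cofinality graph\<close>

text \<open>The choice \<open>x = y j\<close> is allowed, so \<open>wadj\<close> is reflexive on the
  boundary. Any letter below \<open>d\<close> may be chosen because surjectivity of every
  \<open>\<omega> r\<close> will make all shifts available.\<close>

definition wadj :: "nat \<Rightarrow> nat word \<Rightarrow> nat word \<Rightarrow> bool" where
  "wadj d y z \<longleftrightarrow> (\<exists>j x. x < d \<and> z = y(j := x) \<and>
     (j = 0 \<or> (\<exists>r. j = Suc r \<and> y r = 0 \<and> (\<forall>i<r. y i = d - 1))))"

text \<open>The letters that permit a change at \<open>j\<close> all precede \<open>j\<close>, so
  they survive the change; the letter to restore is \<open>y j\<close>.\<close>

lemma wadj_sym:
  assumes "wadj d y z" "y \<in> boundary d" shows "wadj d z y"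
proof -
  obtain j x where j: "z = y(j := x)" "j = 0 \<or> (\<exists>r. j = Suc r \<and> y r = 0 \<and> (\<forall>i<r. y i = d - 1))"
    using assms(1) unfolding wadj_def by blast
  show ?thesis unfolding wadj_def
  proof (intro exI conjI)
    show "y j < d" using assms(2) by (auto simp: boundary_def)
    show "y = z(j := y j)" using j(1) by simp
    show "j = 0 \<or> (\<exists>r. j = Suc r \<and> z r = 0 \<and> (\<forall>i<r. z i = d - 1))"
      using j(2)
    proof (elim disjE exE conjE)
      fix r assume r: "j = Suc r" "y r = 0" "\<forall>i<r. y i = d - 1"
      then have "z r = 0 \<and> (\<forall>i<r. z i = d - 1)" using j(1) by simp
      then show ?thesis using r(1) by blast
    qed simp
  qed
qed

lemma boundary_less: "y \<in> boundary d \<Longrightarrow> y i < d"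
  by (auto simp: boundary_def)

lemma boundaryI: "(\<And>i. y i < d) \<Longrightarrow> y \<in> boundary d"
  by (auto simp: boundary_def)

lemma Cof_iff: "y \<in> Cof d \<xi> \<longleftrightarrow> y \<in> boundary d \<and> (\<exists>n. \<forall>i\<ge>n. y i = \<xi> i)"
proof -
  have "finite {n. y n \<noteq> \<xi> n} \<longleftrightarrow> (\<exists>n. \<forall>i\<ge>n. y i = \<xi> i)"
    unfolding finite_nat_set_iff_bounded by (auto simp: not_less[symmetric])
  then show ?thesis by (simp add: Cof_def)
qed

text \<open>For \<open>d \<ge> 2\<close> the letters 0 and \<open>d - 1\<close> differ, so at most
  one \<open>r\<close> fits and at most two positions can change.\<close>

lemma finite_wadj:
  assumes "d \<ge> 2" shows "finite {z. wadj d y z}"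
proof -
  let ?S = "{Suc r |r. y r = 0 \<and> (\<forall>i<r. y i = d - 1)}"
  have *: "r = s" if "y r = 0" "\<forall>i<r. y i = d - 1" "y s = 0" "\<forall>i<s. y i = d - 1" for r s
  proof (rule ccontr)
    assume "r \<noteq> s"
    then have "y r = d - 1 \<or> y s = d - 1" using that by (meson nat_neq_iff)
    then show False using that assms by simp
  qed
  have "finite ?S"
  proof (cases "?S = {}")
    case False
    then obtain s where s: "y s = 0" "\<forall>i<s. y i = d - 1" by blast
    have "?S \<subseteq> {Suc s}" using *[OF _ _ s] by blast
    then show ?thesis using finite_subset by blast
  next
    case True
    then show ?thesis by (simp only: finite.emptyI)
  qed
  moreover have "{z. wadj d y z} \<subseteq> (\<Union>j \<in> insert 0 ?S. (\<lambda>x. y(j := x)) ` {..<d})"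
    unfolding wadj_def by blast
  moreover have "finite (\<Union>j \<in> insert 0 ?S. (\<lambda>x. y(j := x)) ` {..<d})"
    using \<open>finite ?S\<close> by (intro finite_UN_I finite_imageI) auto
  ultimately show ?thesis using finite_subset by blast
qed

text \<open>For positive \<open>n\<close>, the setting of the first \<open>n\<close> letters that
  unlocks letter \<open>n\<close>; for \<open>y = \<xi>\<close> it is the first gate of the block of
  level \<open>n\<close>.\<close>

definition joint :: "nat \<Rightarrow> nat \<Rightarrow> nat word \<Rightarrow> nat word" where
  "joint d n y = (\<lambda>i. if Suc i < n then d - 1 else if Suc i = n then 0 else y i)"

lemma joint_boundary: "d \<ge> 2 \<Longrightarrow> y \<in> boundary d \<Longrightarrow> joint d n y \<in> boundary d"
  by (auto simp: joint_def intro!: boundaryI dest: boundary_less)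

lemma joint_tail: "n \<le> i \<Longrightarrow> joint d n y i = y i"
  by (simp add: joint_def)

lemma wadj_joint: "x < d \<Longrightarrow> wadj d (joint d (Suc l) y) ((joint d (Suc l) y)(Suc l := x))"
  unfolding wadj_def by (rule exI[of _ "Suc l"], rule exI[of _ x]) (auto simp: joint_def)

text \<open>Induction as in the Tower of Hanoi: to alter letter \<open>n\<close>, first bring the
  letters below it into the joint configuration, then alter it, then correct the lower letters by
  the induction hypothesis.\<close>

lemma wadj_reachable:
  assumes "d \<ge> 2" "y \<in> Cof d \<xi>" "z \<in> boundary d" "\<forall>i\<ge>n. y i = z i"
  shows "(y, z) \<in> rtrancl_on (Cof d \<xi>) {(a, b). wadj d a b}"
  using assms(2-)
proof (induct n arbitrary: y z)
  case 0
  then have "y = z" by auto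
  then show ?case using 0 by simp
next
  case (Suc n)
  \<comment> \<open>All intermediate words agree with \<open>y\<close> from \<open>Suc n\<close> on,
    so the path never leaves the cofinality class.\<close>
  have Cof: "w \<in> Cof d \<xi>" if "w \<in> boundary d" "\<forall>i\<ge>Suc n. y i = w i" for w
  proof -
    obtain N where "\<forall>i\<ge>N. y i = \<xi> i" using Suc.prems(1) Cof_iff by blast
    then have "\<forall>i\<ge>max N (Suc n). w i = \<xi> i" using that(2) by auto
    then show ?thesis using that(1) Cof_iff by blast
  qed
  have y: "y \<in> boundary d" using Suc.prems(1) Cof_iff by blast
  show ?case
  proof (cases n)
    case 0
    have "z = y(0 := z 0)"
    proof
      show "z i = (y(0 := z 0)) i" for i using Suc.prems(3) 0 by (cases i) auto
    qed
    then have "wadj d y z" unfolding wadj_def using Suc.prems(2) boundary_less by blast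
    then show ?thesis using Suc.prems(1) Cof[OF Suc.prems(2,3)]
      by (auto intro: rtrancl_on_into_rtrancl_on)
  next
    case (Suc l)
    let ?p = "joint d n y"
    let ?q = "?p(n := z n)"
    have p: "?p \<in> boundary d" using joint_boundary assms(1) y by blast
    have q: "?q \<in> boundary d" using p Suc.prems(2) by (auto intro!: boundaryI dest: boundary_less)
    have yp: "(y, ?p) \<in> rtrancl_on (Cof d \<xi>) {(a, b). wadj d a b}"
      using Suc.prems(1) p by (intro Suc.hyps) (auto simp: joint_tail)
    have pq: "wadj d ?p ?q" using wadj_joint[of "z n" d l y] Suc Suc.prems(2) boundary_less by blast
    have qC: "?q \<in> Cof d \<xi>" using q by (intro Cof) (auto simp: joint_tail)
    have qz: "(?q, z) \<in> rtrancl_on (Cof d \<xi>) {(a, b). wadj d a b}"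
    proof (rule Suc.hyps[OF qC Suc.prems(2)], intro allI impI)
      fix i assume "n \<le> i"
      then show "?q i = z i" using Suc.prems(3) by (cases "i = n") (auto simp: joint_tail)
    qed
    have "(y, ?q) \<in> rtrancl_on (Cof d \<xi>) {(a, b). wadj d a b}"
      using pq by (intro rtrancl_on_into_rtrancl_on[OF yp _ qC]) blast
    then show ?thesis using qz by (rule rtrancl_on_trans)
  qed
qed

section \<open>Tails of the base word and exits from finite blocks\<close>

lemma E2_iff:
  assumes "\<xi> \<in> boundary d"
  shows "\<xi> \<in> E2 d \<longleftrightarrow> (\<exists>N. \<forall>i\<ge>N. \<xi> i \<in> {0, d - 1}) \<and> (\<forall>N. \<exists>i\<ge>N. \<xi> i \<noteq> d - 1)"
proof -
  have "(\<exists>w \<zeta>. \<xi> = w \<frown> \<zeta> \<and> w \<in> lists {..<d} \<and> range \<zeta> \<subseteq> {0, d - 1}) \<longleftrightarrow> (\<exists>N. \<forall>i\<ge>N. \<xi> i \<in> {0, d - 1})"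
  proof safe
    fix w :: "nat list" and \<zeta> :: "nat word" assume *: "range \<zeta> \<subseteq> {0, d - 1}"
    have "(w \<frown> \<zeta>) i \<in> {0, d - 1}" if "i \<ge> length w" for i
    proof -
      have "(w \<frown> \<zeta>) i = \<zeta> (i - length w)" using that by (simp add: conc_def)
      then show ?thesis using * by (metis rangeI subsetD)
    qed
    then show "\<exists>N. \<forall>i\<ge>N. (w \<frown> \<zeta>) i \<in> {0, d - 1}" by blast
  next
    fix N assume N: "\<forall>i\<ge>N. \<xi> i \<in> {0, d - 1}"
    have "\<xi> = prefix N \<xi> \<frown> suffix N \<xi>" by (rule prefix_suffix)
    moreover have "prefix N \<xi> \<in> lists {..<d}"
      using assms by (auto simp: subsequence_def dest: boundary_less)
    moreover have "range (suffix N \<xi>) \<subseteq> {0, d - 1}"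
      unfolding suffix_def by (intro image_subsetI N[rule_format]) simp
    ultimately show "\<exists>w \<zeta>. \<xi> = w \<frown> \<zeta> \<and> w \<in> lists {..<d} \<and> range \<zeta> \<subseteq> {0, d - 1}" by metis
  qed
  moreover have "\<xi> \<in> Cof d (\<lambda>_. d - 1) \<longleftrightarrow> \<not> (\<forall>N. \<exists>i\<ge>N. \<xi> i \<noteq> d - 1)"
    using assms by (auto simp: Cof_iff)
  ultimately show ?thesis unfolding E2_def by blast
qed

text \<open>Either letters outside \<open>{0, d - 1}\<close> occur arbitrarily far out and
  \<open>n\<close> is chosen at one of them, or the tail is constantly \<open>d - 1\<close> and
  contains no 0 at all.\<close>

lemma not_E2_no_exit:
  assumes "d \<ge> 2" "\<xi> \<in> boundary d" "\<xi> \<notin> E2 d"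
  obtains n where "n \<ge> N" "\<nexists>r. n \<le> r \<and> \<xi> r = 0 \<and> (\<forall>i. n \<le> i \<longrightarrow> i < r \<longrightarrow> \<xi> i = d - 1)"
proof (cases "\<forall>N. \<exists>i\<ge>N. \<xi> i \<noteq> d - 1")
  case True
  then obtain n where n: "n \<ge> N" "\<xi> n \<notin> {0, d - 1}" using assms(2,3) E2_iff by blast
  have "\<nexists>r. n \<le> r \<and> \<xi> r = 0 \<and> (\<forall>i. n \<le> i \<longrightarrow> i < r \<longrightarrow> \<xi> i = d - 1)"
    using n(2) by (metis insertCI le_neq_implies_less order_refl)
  then show ?thesis using n(1) that by blast
next
  case False
  then obtain M where M: "\<forall>i\<ge>M. \<xi> i = d - 1" by blast
  show ?thesis
    by (rule that[of "max N M"]) (use M assms(1) in auto)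
qed

lemma finite_block: "finite {y \<in> boundary d. \<forall>i\<ge>n. y i = \<xi> i}"
proof (rule finite_subset)
  show "{y \<in> boundary d. \<forall>i\<ge>n. y i = \<xi> i} \<subseteq> (\<lambda>w. w \<frown> suffix n \<xi>) ` {w. set w \<subseteq> {..<d} \<and> length w = n}"
  proof safe
    fix y assume y: "y \<in> boundary d" "\<forall>i\<ge>n. y i = \<xi> i"
    have "suffix n y = suffix n \<xi>" using y(2) by (auto simp: suffix_def)
    then have "y = prefix n y \<frown> suffix n \<xi>" using prefix_suffix[of y n] by simp
    moreover have "set (prefix n y) \<subseteq> {..<d}" using y(1) by (auto simp: subsequence_def dest: boundary_less)
    ultimately show "y \<in> (\<lambda>w. w \<frown> suffix n \<xi>) ` {w. set w \<subseteq> {..<d} \<and> length w = n}"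
      by (intro image_eqI[of _ _ "prefix n y"]) auto
  qed
qed (simp add: finite_lists_length_eq)

text \<open>Leaving the block changes a letter \<open>j = Suc r \<ge> n\<close>, so \<open>y\<close>
  starts with \<open>(d - 1)\<^sup>r 0\<close>. For \<open>r = n - 1\<close> this is the first gate;
  for \<open>r \<ge> n\<close> the pattern extends into the tail of \<open>\<xi>\<close> and gives
  the second.\<close>

lemma block_exit:
  assumes "d \<ge> 2" "wadj d y z" "\<forall>i\<ge>n. y i = \<xi> i" "\<not> (\<forall>i\<ge>n. z i = \<xi> i)" "n \<ge> 1"
  shows "y = joint d n \<xi> \<or> (y = (\<lambda>i. if i < n then d - 1 else \<xi> i) \<and>
      (\<exists>r\<ge>n. \<xi> r = 0 \<and> (\<forall>i. n \<le> i \<longrightarrow> i < r \<longrightarrow> \<xi> i = d - 1)))"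
proof -
  obtain j x where j: "z = y(j := x)" "j = 0 \<or> (\<exists>r. j = Suc r \<and> y r = 0 \<and> (\<forall>i<r. y i = d - 1))"
    using assms(2) unfolding wadj_def by blast
  then have "j \<ge> n" using assms(3,4) by (metis fun_upd_other leI not_le)
  then obtain r where r: "j = Suc r" "y r = 0" "\<forall>i<r. y i = d - 1" using j(2) assms(5) by auto
  show ?thesis
  proof (cases "n \<le> r")
    case True
    then have "y = (\<lambda>i. if i < n then d - 1 else \<xi> i)" using r(3) assms(3) by auto
    moreover have "\<xi> r = 0 \<and> (\<forall>i. n \<le> i \<longrightarrow> i < r \<longrightarrow> \<xi> i = d - 1)"
      using True r assms(3) by (metis)
    ultimately show ?thesis using True by blast
  next
    case False
    then have "n = Suc r" using \<open>j \<ge> n\<close> r(1) by simp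
    then have "y = joint d n \<xi>" using r assms(3) by (auto simp: joint_def)
    then show ?thesis by blast
  qed
qed

section \<open>Ends of the cofinality graph\<close>

definition zeros :: "nat word \<Rightarrow> nat \<Rightarrow> nat \<Rightarrow> nat" where
  "zeros \<xi> n k = card {i. n \<le> i \<and> i < k \<and> \<xi> i = 0}"

lemma zeros_Suc: "n \<le> k \<Longrightarrow> zeros \<xi> n (Suc k) = zeros \<xi> n k + (if \<xi> k = 0 then 1 else 0)"
proof -
  assume "n \<le> k"
  then have "{i. n \<le> i \<and> i < Suc k \<and> \<xi> i = 0} =
      (if \<xi> k = 0 then insert k else id) {i. n \<le> i \<and> i < k \<and> \<xi> i = 0}"
    by (auto simp: less_Suc_eq)
  then show ?thesis by (auto simp: zeros_def)
qed

lemma zeros_cong: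
  "(\<And>i. n \<le> i \<Longrightarrow> \<xi> i = 0 \<Longrightarrow> i < k \<longleftrightarrow> i < l) \<Longrightarrow> zeros \<xi> n k = zeros \<xi> n l"
  unfolding zeros_def by (metis (no_types, lifting))

definition last_diff :: "nat word \<Rightarrow> nat word \<Rightarrow> nat \<Rightarrow> bool" where
  "last_diff \<xi> y k \<longleftrightarrow> y k \<noteq> \<xi> k \<and> (\<forall>i>k. y i = \<xi> i)"

lemma last_diff_unique: "last_diff \<xi> y k \<Longrightarrow> last_diff \<xi> y l \<Longrightarrow> k = l"
  unfolding last_diff_def by (metis linorder_neqE_nat)

lemma last_diff_exists:
  assumes "\<forall>i\<ge>N. y i = \<xi> i" "n \<le> i" "y i \<noteq> \<xi> i"
  obtains k where "n \<le> k" "last_diff \<xi> y k"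
proof -
  let ?D = "{i. y i \<noteq> \<xi> i}"
  have "?D \<subseteq> {..<N}" using assms(1) by (auto simp: not_le[symmetric])
  then have D: "finite ?D" "i \<in> ?D" using assms(3) finite_subset by auto
  have "y i = \<xi> i" if "i > Max ?D" for i
    using that Max_ge[OF D(1), of i] by auto
  moreover have "y (Max ?D) \<noteq> \<xi> (Max ?D)" using Max_in[OF D(1)] D(2) by blast
  moreover have "n \<le> Max ?D" using Max_ge[OF D] assms(2) by simp
  ultimately show ?thesis using that unfolding last_diff_def by blast
qed

text \<open>
  The vertex \<open>joint d n \<xi>\<close> separates the two sides. For \<open>k > n\<close> the two gates \<open>joint d k \<xi>\<close> and
  \<open>(d - 1)\<^sup>k \<xi>\<^sub>k \<xi>\<^sub>k\<^sub>+\<^sub>1 \<dots>\<close> of the block of level \<open>k\<close> lie on different sides, and the second of them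
  becomes \<open>joint d (k + 1) \<xi>\<close> exactly when \<open>\<xi> k = 0\<close>; hence the parity.
\<close>

definition side :: "nat word \<Rightarrow> nat \<Rightarrow> nat word \<Rightarrow> bool" where
  "side \<xi> n y \<longleftrightarrow> (\<forall>i\<ge>n. y i = \<xi> i) \<or> (\<exists>k\<ge>n. last_diff \<xi> y k \<and> odd (zeros \<xi> n k))"

lemma side_last_diff:
  assumes "n \<le> k" "last_diff \<xi> y k" shows "side \<xi> n y \<longleftrightarrow> odd (zeros \<xi> n k)"
  unfolding side_def using assms last_diff_unique by (metis last_diff_def)

text \<open>The last disagreement is at \<open>j - 1\<close> if \<open>\<xi>\<close> is nonzero
  there. Otherwise it is at the preceding zero of \<open>\<xi>\<close>, and counting up to
  \<open>j\<close> adds exactly these two zeros, so the parity persists. If no zero precedes from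
  \<open>n\<close> on, the count is 1 and the tails agree.\<close>

lemma side_joint:
  assumes "d \<ge> 2" "\<forall>i\<ge>n. \<xi> i \<in> {0, d - 1}" "n < j"
  shows "side \<xi> n (joint d j \<xi>) \<longleftrightarrow> odd (zeros \<xi> n j)"
proof -
  let ?y = "joint d j \<xi>"
  obtain l where l: "j = Suc l" "n \<le> l" using assms(3) by (cases j) auto
  have tail: "\<forall>i>l. ?y i = \<xi> i" using l by (simp add: joint_def)
  have yl: "?y l = 0" and below: "\<And>i. i < l \<Longrightarrow> ?y i = d - 1" using l by (auto simp: joint_def)
  have ld: "side \<xi> n ?y \<longleftrightarrow> odd (zeros \<xi> n i)" if "n \<le> i" "last_diff \<xi> ?y i" for i
    using that by (rule side_last_diff)
  show ?thesis
  proof (cases "\<xi> l = 0")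
    case False
    then have "last_diff \<xi> ?y l" using yl tail by (simp add: last_diff_def)
    then show ?thesis using ld[OF l(2)] zeros_Suc[OF l(2), of \<xi>] False l(1) by simp
  next
    case True
    have tail': "\<forall>i\<ge>l. ?y i = \<xi> i" using tail yl True by (metis le_neq_implies_less)
    show ?thesis
    proof (cases "\<forall>i\<ge>n. ?y i = \<xi> i")
      case True': True
      have nz: "\<xi> i \<noteq> 0" if "n \<le> i" "i < l" for i
      proof -
        have "\<xi> i = d - 1" using True' below[of i] that by simp
        then show ?thesis using assms(1) by simp
      qed
      have "zeros \<xi> n l = zeros \<xi> n n"
      proof (rule zeros_cong)
        fix i assume "n \<le> i" "\<xi> i = 0"
        then show "i < l \<longleftrightarrow> i < n" using nz[of i] by linarith
      qed
      also have "\<dots> = 0" by (simp add: zeros_def)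
      finally have "odd (zeros \<xi> n j)" using zeros_Suc[OF l(2), of \<xi>] True l(1) by simp
      moreover have "side \<xi> n ?y" using True' by (simp add: side_def)
      ultimately show ?thesis by simp
    next
      case False
      then obtain i0 where "n \<le> i0" "?y i0 \<noteq> \<xi> i0" by blast
      then obtain k where k: "n \<le> k" "last_diff \<xi> ?y k" using last_diff_exists tail' by metis
      have kl: "k < l" using k(2) tail' unfolding last_diff_def by (meson leI)
      \<comment> \<open>Below \<open>l\<close> every joint letter is \<open>d - 1\<close>, so a
        disagreement at \<open>k \<ge> n\<close> can only be a zero of \<open>\<xi>\<close>.\<close>
      have "\<xi> k \<noteq> d - 1" using below[OF kl] k(2) by (auto simp: last_diff_def)
      then have "\<xi> k = 0" using assms(2) k(1) by blast
      then have Sk: "zeros \<xi> n (Suc k) = zeros \<xi> n k + 1" using zeros_Suc[OF k(1), of \<xi>] by simp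
      have nz: "\<xi> i \<noteq> 0" if "k < i" "i < l" for i
        using that k(2) below[of i] assms(1) by (auto simp: last_diff_def)
      have "zeros \<xi> n l = zeros \<xi> n (Suc k)"
      proof (rule zeros_cong)
        fix i assume "\<xi> i = 0"
        then show "i < l \<longleftrightarrow> i < Suc k" using nz[of i] kl by linarith
      qed
      then have "zeros \<xi> n j = zeros \<xi> n k + 2" using Sk zeros_Suc[OF l(2), of \<xi>] True l(1) by simp
      then show ?thesis using ld[OF k] by simp
    qed
  qed
qed

text \<open>Only a change at some \<open>j \<ge> n\<close> with agreement beyond \<open>j\<close>
  matters. Then both words start with the same \<open>(d - 1)\<^sup>r 0\<close>, so each one either
  differs last at \<open>j\<close> or equals \<open>joint d j \<xi>\<close>, and in both cases the
  side is the parity of \<open>zeros \<xi> n j\<close>.\<close>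

lemma side_wadj:
  assumes "d \<ge> 2" "\<forall>i\<ge>n. \<xi> i \<in> {0, d - 1}" "n \<ge> 1" "wadj d y z"
    "y \<noteq> joint d n \<xi>" "z \<noteq> joint d n \<xi>"
  shows "side \<xi> n y \<longleftrightarrow> side \<xi> n z"
proof -
  obtain j x where j: "z = y(j := x)" "j = 0 \<or> (\<exists>r. j = Suc r \<and> y r = 0 \<and> (\<forall>i<r. y i = d - 1))"
    using assms(4) unfolding wadj_def by blast
  have yz: "z i = y i" if "i \<noteq> j" for i using j(1) that by simp
  \<comment> \<open>A change below \<open>n\<close>, or below a later disagreement, affects neither
    clause of \<open>side\<close>.\<close>
  have same: ?thesis if "j < n \<or> (\<exists>i>j. y i \<noteq> \<xi> i)"
  proof -
    have "last_diff \<xi> y k \<longleftrightarrow> last_diff \<xi> z k" if "k \<ge> n" for k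
    proof -
      show "last_diff \<xi> y k \<longleftrightarrow> last_diff \<xi> z k"
      proof (cases "k > j")
        case True
        then have "\<forall>i\<ge>k. z i = y i" using yz by simp
        then show ?thesis by (simp add: last_diff_def)
      next
        case False
        then obtain i where i: "i > j" "y i \<noteq> \<xi> i" using \<open>j < n \<or> _\<close> \<open>k \<ge> n\<close> by auto
        then have "i > k" "z i \<noteq> \<xi> i" using False yz[of i] by auto
        then show ?thesis using i(2) by (auto simp: last_diff_def)
      qed
    qed
    moreover have "(\<forall>i\<ge>n. y i = \<xi> i) \<longleftrightarrow> (\<forall>i\<ge>n. z i = \<xi> i)"
    proof (cases "j < n")
      case True
      then have "\<forall>i\<ge>n. z i = y i" using yz by simp
      then show ?thesis by simp
    next
      case False
      then obtain i where "i > j" "y i \<noteq> \<xi> i" "i \<ge> n" using \<open>j < n \<or> _\<close> by auto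
      then show ?thesis using yz[of i] by auto
    qed
    ultimately show ?thesis unfolding side_def by blast
  qed
  show ?thesis
  proof (cases "j < n \<or> (\<exists>i>j. y i \<noteq> \<xi> i)")
    case False
    then have jn: "n \<le> j" and ty: "\<forall>i>j. y i = \<xi> i" by auto
    then have tz: "\<forall>i>j. z i = \<xi> i" using yz by simp
    obtain r where r: "j = Suc r" "y r = 0" "\<forall>i<r. y i = d - 1" using j(2) jn assms(3) by auto
    have r': "z r = 0" "\<forall>i<r. z i = d - 1" using r yz by auto
    have joint: "w = joint d j \<xi>"
      if "w j = \<xi> j" "\<forall>i>j. w i = \<xi> i" "w r = 0" "\<forall>i<r. w i = d - 1" for w
    proof
      fix i show "w i = joint d j \<xi> i"
        using that r(1) by (cases i j rule: linorder_cases) (auto simp: joint_def less_Suc_eq)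
    qed
    have one: "side \<xi> n w \<longleftrightarrow> odd (zeros \<xi> n j)"
      if "w \<noteq> joint d n \<xi>" "\<forall>i>j. w i = \<xi> i" "w r = 0" "\<forall>i<r. w i = d - 1" for w
    proof (cases "w j = \<xi> j")
      case True
      then have w: "w = joint d j \<xi>" using joint that by blast
      \<comment> \<open>For \<open>j = n\<close> the formula fails: \<open>joint d n \<xi>\<close>
        satisfies the first clause of \<open>side\<close>, while \<open>zeros \<xi> n n\<close> is
        0. This is why the cut vertex is excluded.\<close>
      have "n \<noteq> j" using that(1) w by auto
      then have "n < j" using jn by simp
      then show ?thesis using side_joint[OF assms(1,2)] w by blast
    next
      case False
      then show ?thesis using side_last_diff[OF jn] that(2) by (simp add: last_diff_def)
    qed
    show ?thesis using one[OF assms(5) ty r(2,3)] one[OF assms(6) tz r'] by simp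
  qed (rule same)
qed

section \<open>Infinitude of both sides\<close>

lemma zeros_parity:
  assumes "\<forall>N. \<exists>i\<ge>N. \<xi> i = 0" shows "\<exists>k\<ge>N. n \<le> k \<and> odd (zeros \<xi> n k) = b"
proof -
  obtain i where i: "i \<ge> max N n" "\<xi> i = 0" using assms by blast
  then have "zeros \<xi> n (Suc i) = Suc (zeros \<xi> n i)" using zeros_Suc[of n i \<xi>] by simp
  \<comment> \<open>Passing a zero flips the parity, so one of \<open>i\<close> and
    \<open>Suc i\<close> has the prescribed one.\<close>
  then have "odd (zeros \<xi> n (Suc i)) = b \<or> odd (zeros \<xi> n i) = b" by auto
  then show ?thesis using i(1) by (metis le_SucI max.bounded_iff)
qed

lemma infinite_last_diff:
  assumes "d \<ge> 2" "\<xi> \<in> boundary d" "infinite K"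
  shows "infinite {y \<in> Cof d \<xi> - {v}. \<exists>k\<in>K. last_diff \<xi> y k}"
proof -
  \<comment> \<open>The new letter is below \<open>d\<close> and differs from
    \<open>\<xi> k\<close>, so different \<open>k\<close> give words with different last
    disagreements.\<close>
  define f where "f k = \<xi>(k := if \<xi> k = 0 then d - 1 else 0)" for k
  have ld: "last_diff \<xi> (f k) k" for k using assms(1) by (simp add: f_def last_diff_def)
  have fC: "f k \<in> Cof d \<xi>" for k
    unfolding Cof_iff
  proof
    show "f k \<in> boundary d"
      using assms(1,2) by (auto simp: f_def intro!: boundaryI dest: boundary_less)
    show "\<exists>n. \<forall>i\<ge>n. f k i = \<xi> i" by (rule exI[of _ "Suc k"]) (simp add: f_def)
  qed
  have "inj_on f K" using ld last_diff_unique by (metis inj_onI)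
  then have "infinite (f ` K - {v})" using assms(3) by (simp add: finite_image_iff)
  moreover have "f ` K - {v} \<subseteq> {y \<in> Cof d \<xi> - {v}. \<exists>k\<in>K. last_diff \<xi> y k}"
    using fC ld by blast
  ultimately show ?thesis using finite_subset by blast
qed

lemma infinite_side:
  assumes "d \<ge> 2" "\<xi> \<in> boundary d" "\<forall>N. \<exists>i\<ge>N. \<xi> i = 0"
  shows "infinite {y \<in> Cof d \<xi> - {v}. side \<xi> n y = b}"
proof -
  let ?K = "{k. n \<le> k \<and> odd (zeros \<xi> n k) = b}"
  have "infinite ?K" unfolding infinite_nat_iff_unbounded_le using zeros_parity[OF assms(3)] by blast
  then have "infinite {y \<in> Cof d \<xi> - {v}. \<exists>k\<in>?K. last_diff \<xi> y k}"
    by (rule infinite_last_diff[OF assms(1,2)])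
  moreover have "{y \<in> Cof d \<xi> - {v}. \<exists>k\<in>?K. last_diff \<xi> y k} \<subseteq> {y \<in> Cof d \<xi> - {v}. side \<xi> n y = b}"
    using side_last_diff by auto
  ultimately show ?thesis using finite_subset by blast
qed

lemma infinite_Cof:
  assumes "d \<ge> 2" "\<xi> \<in> boundary d" shows "infinite (Cof d \<xi> - {v})"
proof -
  have "infinite {y \<in> Cof d \<xi> - {v}. \<exists>k\<in>UNIV. last_diff \<xi> y k}"
    using infinite_last_diff assms infinite_UNIV_nat by blast
  then show ?thesis by (rule contrapos_nn) simp
qed

text \<open>Only the vertex set and the adjacency enter, so the ends are counted on words without
  reference to the group.\<close>

lemma ended_iff_cofinality_graph:
  assumes d: "d \<ge> 2" and \<xi>: "\<xi> \<in> boundary d"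
    and adj: "adjacency \<Gamma> (wadj d)" and V: "verts \<Gamma> = Cof d \<xi>"
  shows "(ended 2 \<Gamma> \<longleftrightarrow> \<xi> \<in> E2 d) \<and> (ended 1 \<Gamma> \<longleftrightarrow> \<xi> \<in> E1 d)"
proof -
  interpret adjacency \<Gamma> "wadj d" by (rule adj)
  have \<xi>C: "\<xi> \<in> Cof d \<xi>" using \<xi> by (simp add: Cof_iff)
  have connected: "conn (verts \<Gamma>) x v" if "x \<in> verts \<Gamma>" "v \<in> verts \<Gamma>" for x v
  proof -
    have xv: "x \<in> Cof d \<xi>" "v \<in> Cof d \<xi>" using that V by auto
    then obtain N M where "\<forall>i\<ge>N. x i = \<xi> i" "\<forall>i\<ge>M. v i = \<xi> i" using Cof_iff by blast
    then have "\<forall>i\<ge>max N M. x i = v i" by simp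
    moreover have "v \<in> boundary d" using xv Cof_iff by blast
    ultimately show ?thesis
      unfolding conn_def V by (intro wadj_reachable[OF d xv(1)])
  qed
  have fin: "finite {w \<in> verts \<Gamma>. wadj d v w}" for v
    using finite_wadj[OF d, of v] by (rule rev_finite_subset) blast
  have block: "\<exists>F' P. F \<subseteq> F' \<and> finite F' \<and> finite P \<and> card P \<le> k \<and>
      (\<forall>y \<in> F'. \<forall>z \<in> verts \<Gamma> - F'. wadj d y z \<longrightarrow> y \<in> P)"
    if F: "finite F" "F \<subseteq> verts \<Gamma>" and k: "k = 2 \<or> k = 1 \<and> \<xi> \<notin> E2 d" for F k
  proof -
    have "\<forall>y\<in>F. \<exists>N. y \<in> boundary d \<and> (\<forall>i\<ge>N. y i = \<xi> i)" using F(2) V Cof_iff by blast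
    then obtain N where N: "\<And>y. y \<in> F \<Longrightarrow> y \<in> boundary d \<and> (\<forall>i\<ge>N y. y i = \<xi> i)" by metis
    \<comment> \<open>The inserted 1 makes the maximum meaningful for empty \<open>F\<close> and
      keeps the level positive, as \<open>block_exit\<close> requires.\<close>
    let ?M = "Max (insert 1 (N ` F))"
    let ?exit = "\<lambda>n. \<exists>r\<ge>n. \<xi> r = 0 \<and> (\<forall>i. n \<le> i \<longrightarrow> i < r \<longrightarrow> \<xi> i = d - 1)"
    \<comment> \<open>The level lies beyond all disagreements of members of \<open>F\<close> with
      \<open>\<xi>\<close>; for \<open>k = 1\<close> it is moreover chosen with the second gate
      closed.\<close>
    obtain n where n: "n \<ge> ?M" "k = 2 \<or> k = 1 \<and> \<not> ?exit n"
      using k not_E2_no_exit[OF d \<xi>, of ?M] by blast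
    let ?B = "{y \<in> boundary d. \<forall>i\<ge>n. y i = \<xi> i}"
    let ?P = "insert (joint d n \<xi>) (if k = 2 then {\<lambda>i. if i < n then d - 1 else \<xi> i} else {})"
    have n1: "n \<ge> 1" and nN: "\<And>y. y \<in> F \<Longrightarrow> N y \<le> n" using n(1) F(1) by auto
    have "F \<subseteq> ?B" using N nN order_trans by blast
    moreover have "y \<in> ?P" if "y \<in> ?B" "z \<in> verts \<Gamma> - ?B" "wadj d y z" for y z
    proof -
      have "\<not> (\<forall>i\<ge>n. z i = \<xi> i)" using that(2) V Cof_iff by blast
      then show ?thesis using block_exit[OF d that(3) _ _ n1, of \<xi>] that(1) n(2) by auto
    qed
    moreover have "card ?P \<le> k" using n(2) by (auto simp: card_insert_if)
    moreover have "finite ?P" by simp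
    ultimately show ?thesis using finite_block[of d n \<xi>] by (intro exI[of _ ?B] exI[of _ ?P]) blast
  qed
  have le2: "at_most_ended 2 \<Gamma>" by (rule at_most_endedI, rule block) auto
  have le1: "at_most_ended 1 \<Gamma>" if "\<xi> \<notin> E2 d" by (rule at_most_endedI, rule block) (use that in auto)
  have not0: "\<not> at_most_ended 0 \<Gamma>"
  proof
    assume *: "at_most_ended 0 \<Gamma>"
    \<comment> \<open>With \<open>D\<close> the whole graph minus \<open>\<xi>\<close>,
      connectedness and local finiteness already force an infinite component.\<close>
    obtain C where "C \<in> inf_components_del \<Gamma> \<xi>" "C \<subseteq> verts \<Gamma> - {\<xi>}"
      by (rule inf_component_in_closed_set[of \<xi> "verts \<Gamma> - {\<xi>}"])
         (use \<xi>C V connected fin infinite_Cof[OF d \<xi>] in auto)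
    then show False using * \<xi>C V unfolding at_most_ended_def by auto
  qed
  have not1: "\<not> at_most_ended 1 \<Gamma>" if E2: "\<xi> \<in> E2 d"
  proof
    assume *: "at_most_ended 1 \<Gamma>"
    obtain N where N: "\<forall>i\<ge>N. \<xi> i \<in> {0, d - 1}" and inf: "\<forall>N. \<exists>i\<ge>N. \<xi> i \<noteq> d - 1"
      using E2 E2_iff[OF \<xi>] by blast
    have zero: "\<forall>M. \<exists>i\<ge>M. \<xi> i = 0"
    proof
      fix M
      obtain i where "i \<ge> max N M" "\<xi> i \<noteq> d - 1" using inf by blast
      then have "M \<le> i" "\<xi> i = 0" using N by auto
      then show "\<exists>i\<ge>M. \<xi> i = 0" by blast
    qed
    \<comment> \<open>The level is a successor because \<open>side_wadj\<close> needs it positive;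
      its first gate \<open>?v\<close> is the cut vertex.\<close>
    let ?n = "Suc N"
    let ?v = "joint d ?n \<xi>"
    have N': "\<forall>i\<ge>?n. \<xi> i \<in> {0, d - 1}" using N by simp
    have "\<forall>i\<ge>?n. ?v i = \<xi> i" by (simp add: joint_tail)
    then have v: "?v \<in> verts \<Gamma>" using joint_boundary[OF d \<xi>, of ?n] V Cof_iff by blast
    \<comment> \<open>Each truth value of \<open>side\<close> gives an infinite set that is closed
      under adjacency away from \<open>?v\<close>, hence contains an infinite component.\<close>
    have comp: "\<exists>C. C \<in> inf_components_del \<Gamma> ?v \<and> C \<subseteq> {y \<in> verts \<Gamma> - {?v}. side \<xi> ?n y = b}" for b
    proof -
      let ?D = "{y \<in> verts \<Gamma> - {?v}. side \<xi> ?n y = b}"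
      obtain C where "C \<in> inf_components_del \<Gamma> ?v" "C \<subseteq> ?D"
      proof (rule inf_component_in_closed_set[of ?v ?D])
        show "infinite ?D" using infinite_side[OF d \<xi> zero] V by simp
        show "z \<in> ?D" if "y \<in> ?D" "z \<in> verts \<Gamma> - {?v}" "wadj d y z" for y z
          using that side_wadj[OF d N' _ that(3)] by simp
      qed (use v connected fin in auto)
      then show ?thesis by blast
    qed
    obtain C where C: "C \<in> inf_components_del \<Gamma> ?v" "C \<subseteq> {y \<in> verts \<Gamma> - {?v}. side \<xi> ?n y = True}"
      using comp[of True] by blast
    obtain C' where C': "C' \<in> inf_components_del \<Gamma> ?v" "C' \<subseteq> {y \<in> verts \<Gamma> - {?v}. side \<xi> ?n y = False}"
      using comp[of False] by blast
    have "infinite C" using C(1) by (simp add: inf_components_del_def)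
    then have "C \<noteq> {}" by auto
    then have "C \<noteq> C'" using C(2) C'(2) by auto
    moreover have "finite (inf_components_del \<Gamma> ?v)" "card (inf_components_del \<Gamma> ?v) \<le> Suc 0"
      using * v unfolding at_most_ended_def by auto
    ultimately show False using C(1) C'(1) card_le_Suc0_iff_eq by blast
  qed
  have less2: "j < 2 \<longleftrightarrow> j = 0 \<or> j = 1" for j :: nat by auto
  have "ended 2 \<Gamma> \<longleftrightarrow> \<xi> \<in> E2 d"
    using le2 le1 not0 not1 unfolding ended_def less2 by blast
  moreover have "ended 1 \<Gamma> \<longleftrightarrow> \<xi> \<in> E1 d"
    using le1 not0 not1 \<xi> unfolding ended_def E1_def by auto
  ultimately show ?thesis by blast
qed

section \<open>Schreier graphs of spinal groups\<close>

text \<open>Compatibility with prefixes is the form of a tree endomorphism that passes to infinite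
  words; extensionality is included because elements of \<open>BijGroup\<close> are
  extensional.\<close>

definition level_map :: "nat \<Rightarrow> tree_map \<Rightarrow> bool" where
  "level_map d g \<longleftrightarrow> g \<in> extensional (lists {..<d}) \<and>
     (\<forall>u \<in> lists {..<d}. g u \<in> lists {..<d} \<and> length (g u) = length u \<and>
        (\<forall>k. g (take k u) = take k (g u)))"

lemma level_mapD:
  assumes "level_map d g" "u \<in> lists {..<d}"
  shows "g u \<in> lists {..<d}" "length (g u) = length u" "g (take k u) = take k (g u)"
  using assms by (auto simp: level_map_def)

lemma take_in_lists: "u \<in> lists A \<Longrightarrow> take k u \<in> lists A"
  by (auto simp: in_lists_conv_set dest: in_set_takeD)

lemma level_map_compose:
  assumes "level_map d g" "level_map d h" shows "level_map d (compose (lists {..<d}) g h)"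
  unfolding level_map_def
proof (intro conjI ballI allI)
  fix u k assume u: "u \<in> lists {..<d}"
  note h = level_mapD[OF assms(2) u] and gh = level_mapD[OF assms(1) level_mapD(1)[OF assms(2) u]]
  show "compose (lists {..<d}) g h u \<in> lists {..<d}"
    "length (compose (lists {..<d}) g h u) = length u"
    using u h gh by (simp_all add: compose_def)
  show "compose (lists {..<d}) g h (take k u) = take k (compose (lists {..<d}) g h u)"
    using u h gh take_in_lists[OF u, of k] by (simp add: compose_def)
qed simp

lemma tree_adj_level_map:
  assumes "level_map d g" "u \<in> lists {..<d}" "v \<in> lists {..<d}" "tree_adj u v"
  shows "tree_adj (g u) (g v)"
proof -
  have "\<exists>y. g b = g a @ [y]" if "b \<in> lists {..<d}" "b = a @ [x]" for a b x
  proof -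
    have "g a = take (length a) (g b)" using level_mapD(3)[OF assms(1) that(1), of "length a"] that(2) by simp
    moreover have len: "length (g b) = Suc (length a)" using level_mapD(2)[OF assms(1) that(1)] that(2) by simp
    ultimately have "g b = g a @ [g b ! length a]"
      using take_Suc_conv_app_nth[of "length a" "g b"] by simp
    then show ?thesis by blast
  qed
  note ext = this
  obtain x where "v = u @ [x] \<or> u = v @ [x]" using assms(4) unfolding tree_adj_def by blast
  then show ?thesis
  proof
    assume "v = u @ [x]"
    then show ?thesis using ext[OF assms(3)] unfolding tree_adj_def by blast
  next
    assume "u = v @ [x]"
    then show ?thesis using ext[OF assms(2)] unfolding tree_adj_def by blast
  qed
qed

context
  fixes d :: nat and g h :: tree_map
  assumes g: "level_map d g" and h: "level_map d h"
    and hg: "\<And>u. u \<in> lists {..<d} \<Longrightarrow> h (g u) = u"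
    and gh: "\<And>u. u \<in> lists {..<d} \<Longrightarrow> g (h u) = u"
begin

lemma level_map_Bij: "g \<in> Bij (lists {..<d})"
proof -
  have "bij_betw g (lists {..<d}) (lists {..<d})"
  proof (rule bij_betw_byWitness[where f' = h])
    show "g ` lists {..<d} \<subseteq> lists {..<d}" "h ` lists {..<d} \<subseteq> lists {..<d}"
      using level_mapD(1)[OF g] level_mapD(1)[OF h] by blast+
  qed (use hg gh in blast)+
  then show ?thesis using g by (simp add: Bij_def level_map_def)
qed

text \<open>Edges are reflected because the inverse \<open>h\<close> is itself a level map and so
  preserves edges.\<close>

lemma level_map_in_tree_aut: "g \<in> carrier (tree_aut d)"
proof -
  have "g [] = []" using level_mapD(2)[OF g, of "[]"] by simp
  moreover have "tree_adj (g u) (g v) \<longleftrightarrow> tree_adj u v"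
    if u: "u \<in> lists {..<d}" and v: "v \<in> lists {..<d}" for u v
    using tree_adj_level_map[OF g u v]
      tree_adj_level_map[OF h level_mapD(1)[OF g u] level_mapD(1)[OF g v]] hg[OF u] hg[OF v]
    by auto
  ultimately show ?thesis using level_map_Bij by (simp add: tree_aut_def)
qed

end

lemma tree_aut_mult:
  assumes "f \<in> carrier (tree_aut d)" "g \<in> carrier (tree_aut d)"
  shows "f \<otimes>\<^bsub>tree_aut d\<^esub> g = compose (lists {..<d}) f g"
  using assms by (simp add: tree_aut_def BijGroup_def)

lemma tree_aut_one: "\<one>\<^bsub>tree_aut d\<^esub> = (\<lambda>u \<in> lists {..<d}. u)"
  by (simp add: tree_aut_def BijGroup_def)

text \<open>\<open>m_inv\<close> is a definite description, so uniqueness is needed: a left inverse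
  \<open>y\<close> of \<open>g\<close>, evaluated at \<open>h u\<close>, gives
  \<open>y u = h u\<close>.\<close>

lemma tree_aut_inv:
  assumes g: "level_map d g" and h: "level_map d h"
    and hg: "\<And>u. u \<in> lists {..<d} \<Longrightarrow> h (g u) = u"
    and gh: "\<And>u. u \<in> lists {..<d} \<Longrightarrow> g (h u) = u"
  shows "inv\<^bsub>tree_aut d\<^esub> g = h"
proof -
  let ?T = "tree_aut d"
  have gc: "g \<in> carrier ?T" by (rule level_map_in_tree_aut[OF g h hg gh])
  have hc: "h \<in> carrier ?T" by (rule level_map_in_tree_aut[OF h g gh hg])
  have "g \<otimes>\<^bsub>?T\<^esub> h = \<one>\<^bsub>?T\<^esub>"
    unfolding tree_aut_mult[OF gc hc] tree_aut_one compose_def by (rule restrict_ext) (rule gh)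
  moreover have "h \<otimes>\<^bsub>?T\<^esub> g = \<one>\<^bsub>?T\<^esub>"
    unfolding tree_aut_mult[OF hc gc] tree_aut_one compose_def by (rule restrict_ext) (rule hg)
  moreover have "y = h" if y: "y \<in> carrier ?T" "y \<otimes>\<^bsub>?T\<^esub> g = \<one>\<^bsub>?T\<^esub>" for y
  proof (rule extensionalityI[of _ "lists {..<d}"])
    show "y \<in> extensional (lists {..<d})" using y(1) by (auto simp: tree_aut_def Bij_def)
    show "h \<in> extensional (lists {..<d})" using h by (simp add: level_map_def)
    fix u assume u: "u \<in> lists {..<d}"
    have hu: "h u \<in> lists {..<d}" by (rule level_mapD(1)[OF h u])
    have "compose (lists {..<d}) y g (h u) = (\<lambda>u \<in> lists {..<d}. u) (h u)"
      using y(2) unfolding tree_aut_mult[OF y(1) gc] tree_aut_one by (rule fun_cong)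
    then show "y u = h u" unfolding compose_eq[OF hu] restrict_apply'[OF hu] gh[OF u] .
  qed
  ultimately show ?thesis unfolding m_inv_def using hc by (intro the_equality) blast+
qed

section \<open>The action on infinite words\<close>

lemma lists_nth_less: "u \<in> lists {..<d} \<Longrightarrow> i < length u \<Longrightarrow> u ! i < d"
  by (auto simp: in_lists_conv_set)

lemma prefix_in_lists: "y \<in> boundary d \<Longrightarrow> prefix n y \<in> lists {..<d}"
  by (auto simp: subsequence_def dest: boundary_less)

text \<open>\<open>boundary_act\<close> reads letter \<open>i\<close> off the prefix of length
  \<open>i + 1\<close>; prefix compatibility allows any longer prefix instead.\<close>

lemma boundary_act_nth:
  assumes "level_map d g" "y \<in> boundary d" "i < n"
  shows "boundary_act g y i = g (prefix n y) ! i"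
proof -
  have eq: "prefix (Suc i) y = take (Suc i) (prefix n y)"
    using assms(3) by (intro nth_equalityI) (auto simp del: upt_Suc simp: subsequence_def)
  have "g (prefix (Suc i) y) = take (Suc i) (g (prefix n y))"
    unfolding eq by (rule level_mapD(3)[OF assms(1) prefix_in_lists[OF assms(2)]])
  then show ?thesis by (simp add: boundary_act_def)
qed

lemma boundary_act_one:
  assumes "y \<in> boundary d" shows "boundary_act \<one>\<^bsub>tree_aut d\<^esub> y = y"
  unfolding boundary_act_def tree_aut_one restrict_apply'[OF prefix_in_lists[OF assms]]
  by (simp add: nth_append)

lemma boundary_act_boundary:
  assumes "level_map d g" "y \<in> boundary d" shows "boundary_act g y \<in> boundary d"
proof (rule boundaryI)
  fix i
  have "prefix (Suc i) y \<in> lists {..<d}" using prefix_in_lists assms(2) by blast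
  then have "g (prefix (Suc i) y) \<in> lists {..<d}" "i < length (g (prefix (Suc i) y))"
    using level_mapD[OF assms(1)] by auto
  then show "boundary_act g y i < d" unfolding boundary_act_def by (rule lists_nth_less)
qed

lemma prefix_boundary_act:
  assumes "level_map d g" "y \<in> boundary d"
  shows "prefix n (boundary_act g y) = g (prefix n y)"
proof (rule nth_equalityI)
  show "length (prefix n (boundary_act g y)) = length (g (prefix n y))"
    using level_mapD(2)[OF assms(1) prefix_in_lists[OF assms(2)]] by simp
qed (use boundary_act_nth[OF assms] in simp)

lemma boundary_act_compose:
  assumes "level_map d g" "level_map d h" "y \<in> boundary d"
  shows "boundary_act (compose (lists {..<d}) g h) y = boundary_act g (boundary_act h y)"
proof
  fix n
  show "boundary_act (compose (lists {..<d}) g h) y n = boundary_act g (boundary_act h y) n"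
    unfolding boundary_act_def[of "compose _ g h"] boundary_act_def[of g]
    by (simp only: compose_def restrict_apply prefix_in_lists[OF assms(3)] if_True
        prefix_boundary_act[OF assms(2,3)])
qed

text \<open>
  The generators add \<open>\<kappa> i\<close> to the only letter \<open>i\<close> singled out by \<open>c\<close>, if any, where \<open>c\<close> looks only
  at the letters before \<open>i\<close>.
\<close>

definition selector :: "(nat word \<Rightarrow> nat \<Rightarrow> bool) \<Rightarrow> bool" where
  "selector c \<longleftrightarrow> (\<forall>y z i. (\<forall>j<i. y j = z j) \<longrightarrow> c y i = c z i) \<and>
     (\<forall>y i j. c y i \<longrightarrow> c y j \<longrightarrow> i = j)"

lemma selector_cong: "selector c \<Longrightarrow> (\<And>j. j < i \<Longrightarrow> y j = z j) \<Longrightarrow> c y i \<longleftrightarrow> c z i"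
  unfolding selector_def by blast

lemma selector_unique: "selector c \<Longrightarrow> c y i \<Longrightarrow> c y j \<Longrightarrow> i = j"
  unfolding selector_def by blast

text \<open>\<open>c\<close> is applied to \<open>nth u\<close>, whose values past the end of
  \<open>u\<close> are arbitrary; for a selector only the letters before \<open>i\<close> count, so
  this is harmless.\<close>

definition twist :: "nat \<Rightarrow> (nat word \<Rightarrow> nat \<Rightarrow> bool) \<Rightarrow> (nat \<Rightarrow> nat) \<Rightarrow> tree_map" where
  "twist d c \<kappa> = (\<lambda>u \<in> lists {..<d}.
     map (\<lambda>i. if c (nth u) i then (u ! i + \<kappa> i) mod d else u ! i) [0..<length u])"

lemma twist_length: "u \<in> lists {..<d} \<Longrightarrow> length (twist d c \<kappa> u) = length u"
  by (simp add: twist_def)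

lemma twist_nth:
  "u \<in> lists {..<d} \<Longrightarrow> i < length u \<Longrightarrow>
    twist d c \<kappa> u ! i = (if c (nth u) i then (u ! i + \<kappa> i) mod d else u ! i)"
  by (simp add: twist_def)

lemma twist_level_map:
  assumes "selector c" shows "level_map d (twist d c \<kappa>)"
  unfolding level_map_def
proof (intro conjI ballI allI)
  fix u :: "nat list" and k assume u: "u \<in> lists {..<d}"
  show "length (twist d c \<kappa> u) = length u" using u by (rule twist_length)
  have "twist d c \<kappa> u ! i < d" if "i < length u" for i
    using that lists_nth_less[OF u that] by (simp add: twist_nth[OF u])
  then show "twist d c \<kappa> u \<in> lists {..<d}"
    by (auto simp: in_lists_conv_set in_set_conv_nth twist_length[OF u])
  have tu: "take k u \<in> lists {..<d}" using take_in_lists[OF u] .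
  show "twist d c \<kappa> (take k u) = take k (twist d c \<kappa> u)"
  proof (rule nth_equalityI)
    fix i assume "i < length (twist d c \<kappa> (take k u))"
    then have i: "i < k" "i < length u" by (auto simp: twist_length[OF tu])
    moreover have "c (nth (take k u)) i \<longleftrightarrow> c (nth u) i"
      using i by (intro selector_cong[OF assms]) auto
    ultimately show "twist d c \<kappa> (take k u) ! i = take k (twist d c \<kappa> u) ! i"
      by (simp add: twist_nth[OF u] twist_nth[OF tu])
  qed (simp add: twist_length[OF u] twist_length[OF tu])
qed (simp add: twist_def)

text \<open>No letter before the selected one is changed, so a selection in \<open>u\<close>
  persists. Conversely, a changed letter before \<open>i\<close> would be selected in
  \<open>u\<close>, hence also in the twisted word, against uniqueness.\<close>

lemma selector_twist:
  assumes c: "selector c" and u: "u \<in> lists {..<d}" and i: "i < length u"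
  shows "c (nth (twist d c \<kappa> u)) i \<longleftrightarrow> c (nth u) i"
proof -
  let ?z = "twist d c \<kappa> u"
  have fwd: "c (nth ?z) j" if "c (nth u) j" "j < length u" for j
  proof -
    have "?z ! l = u ! l" if "l < j" for l
      using that \<open>j < length u\<close> selector_unique[of c "nth u" j l] c \<open>c (nth u) j\<close>
      by (auto simp: twist_nth[OF u])
    then show ?thesis using selector_cong[OF c, of j "nth ?z" "nth u"] that(1) by blast
  qed
  have "c (nth u) i" if z: "c (nth ?z) i"
  proof -
    have "?z ! j = u ! j" if "j < i" for j
    proof (rule ccontr)
      assume "?z ! j \<noteq> u ! j"
      then have "c (nth u) j" using that i by (auto simp: twist_nth[OF u] split: if_splits)
      then have "c (nth ?z) j" using fwd that i by simp
      then show False using selector_unique[of c "nth ?z" i j] c z that by simp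
    qed
    then show ?thesis using selector_cong[OF c, of i "nth ?z" "nth u"] z by blast
  qed
  then show ?thesis using fwd i by blast
qed

lemma twist_twist:
  assumes c: "selector c" and u: "u \<in> lists {..<d}"
  shows "twist d c \<kappa> (twist d c \<kappa>' u) = twist d c (\<lambda>i. \<kappa> i + \<kappa>' i) u"
proof -
  have u': "twist d c \<kappa>' u \<in> lists {..<d}" using level_mapD(1)[OF twist_level_map[OF c] u] .
  show ?thesis
  proof (rule nth_equalityI)
    fix i assume "i < length (twist d c \<kappa> (twist d c \<kappa>' u))"
    then have i: "i < length u" "i < length (twist d c \<kappa>' u)" by (auto simp: twist_length u u')
    have "((u ! i + \<kappa>' i) mod d + \<kappa> i) mod d = (u ! i + (\<kappa> i + \<kappa>' i)) mod d"
      unfolding mod_add_left_eq by (simp only: ac_simps)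
    then show "twist d c \<kappa> (twist d c \<kappa>' u) ! i = twist d c (\<lambda>i. \<kappa> i + \<kappa>' i) u ! i"
      using selector_twist[OF c u i(1)] by (simp add: twist_nth[OF u' i(2)] twist_nth[OF u i(1)])
  qed (simp add: twist_length u u')
qed

lemma twist_id:
  assumes "u \<in> lists {..<d}" "\<And>i. d dvd \<kappa> i" shows "twist d c \<kappa> u = u"
proof (rule nth_equalityI)
  fix i assume "i < length (twist d c \<kappa> u)"
  then have i: "i < length u" using twist_length[OF assms(1)] by simp
  obtain q where "\<kappa> i = d * q" using assms(2) by blast
  then show "twist d c \<kappa> u ! i = u ! i"
    using lists_nth_less[OF assms(1) i] by (simp add: twist_nth[OF assms(1) i])
qed (simp add: twist_length assms)

text \<open>In natural numbers \<open>(d - 1) * \<kappa> i\<close> stands for minus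
  \<open>\<kappa> i\<close> modulo \<open>d\<close>, as the two add up to
  \<open>d * \<kappa> i\<close>.\<close>

lemma twist_inverse:
  assumes "d > 0" "selector c" "u \<in> lists {..<d}"
  shows "twist d c (\<lambda>i. (d - 1) * \<kappa> i) (twist d c \<kappa> u) = u"
    and "twist d c \<kappa> (twist d c (\<lambda>i. (d - 1) * \<kappa> i) u) = u"
proof -
  have eq: "(d - 1) * \<kappa> i + \<kappa> i = d * \<kappa> i" for i using assms(1) by (cases d) simp_all
  have dvd: "d dvd (d - 1) * \<kappa> i + \<kappa> i" for i unfolding eq by (rule dvd_triv_left)
  have dvd': "d dvd \<kappa> i + (d - 1) * \<kappa> i" for i using dvd[of i] by (simp only: add.commute)
  show "twist d c (\<lambda>i. (d - 1) * \<kappa> i) (twist d c \<kappa> u) = u"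
    unfolding twist_twist[OF assms(2,3)] by (rule twist_id[OF assms(3) dvd])
  show "twist d c \<kappa> (twist d c (\<lambda>i. (d - 1) * \<kappa> i) u) = u"
    unfolding twist_twist[OF assms(2,3)] by (rule twist_id[OF assms(3) dvd'])
qed

lemma twist_in_tree_aut:
  assumes "d > 0" "selector c" shows "twist d c \<kappa> \<in> carrier (tree_aut d)"
proof (rule level_map_in_tree_aut[where h = "twist d c (\<lambda>i. (d - 1) * \<kappa> i)"])
  show "level_map d (twist d c \<kappa>)" "level_map d (twist d c (\<lambda>i. (d - 1) * \<kappa> i))"
    by (rule twist_level_map[OF assms(2)])+
  fix u assume "u \<in> lists {..<d}"
  then show "twist d c (\<lambda>i. (d - 1) * \<kappa> i) (twist d c \<kappa> u) = u"
    "twist d c \<kappa> (twist d c (\<lambda>i. (d - 1) * \<kappa> i) u) = u"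
    by (rule twist_inverse[OF assms])+
qed

lemma twist_inv:
  assumes "d > 0" "selector c"
  shows "inv\<^bsub>tree_aut d\<^esub> (twist d c \<kappa>) = twist d c (\<lambda>i. (d - 1) * \<kappa> i)"
proof (rule tree_aut_inv[where h = "twist d c (\<lambda>i. (d - 1) * \<kappa> i)"])
  show "level_map d (twist d c \<kappa>)" "level_map d (twist d c (\<lambda>i. (d - 1) * \<kappa> i))"
    by (rule twist_level_map[OF assms(2)])+
  fix u assume "u \<in> lists {..<d}"
  then show "twist d c (\<lambda>i. (d - 1) * \<kappa> i) (twist d c \<kappa> u) = u"
    "twist d c \<kappa> (twist d c (\<lambda>i. (d - 1) * \<kappa> i) u) = u"
    by (rule twist_inverse[OF assms])+
qed

lemma twist_mult:
  assumes "d > 0" "selector c"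
  shows "twist d c \<kappa> \<otimes>\<^bsub>tree_aut d\<^esub> twist d c \<kappa>' = twist d c (\<lambda>i. \<kappa> i + \<kappa>' i)"
  unfolding tree_aut_mult[OF twist_in_tree_aut[OF assms] twist_in_tree_aut[OF assms]]
proof (rule extensionalityI[of _ "lists {..<d}"])
  show "twist d c (\<lambda>i. \<kappa> i + \<kappa>' i) \<in> extensional (lists {..<d})" by (simp add: twist_def)
qed (simp_all add: compose_def twist_twist[OF assms(2)])

lemma twist_one:
  assumes "\<And>i. d dvd \<kappa> i" shows "twist d c \<kappa> = \<one>\<^bsub>tree_aut d\<^esub>"
  unfolding tree_aut_one
proof (rule extensionalityI[of _ "lists {..<d}"])
  show "twist d c \<kappa> \<in> extensional (lists {..<d})" by (simp add: twist_def)
qed (simp_all add: twist_id assms)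

lemma boundary_act_twist:
  assumes c: "selector c" and y: "y \<in> boundary d"
  shows "boundary_act (twist d c \<kappa>) y i = (if c y i then (y i + \<kappa> i) mod d else y i)"
proof -
  have "c (nth (prefix (Suc i) y)) i \<longleftrightarrow> c y i" by (rule selector_cong[OF c]) (simp add: nth_append)
  then show ?thesis
    unfolding boundary_act_def using twist_nth[OF prefix_in_lists[OF y], of i "Suc i"]
    by (simp add: nth_append)
qed

section \<open>The letters moved by the rooted and by the spinal generators\<close>

definition first_letter :: "nat word \<Rightarrow> nat \<Rightarrow> bool" where
  "first_letter y i \<longleftrightarrow> i = 0"

definition spine_letter :: "nat \<Rightarrow> nat word \<Rightarrow> nat \<Rightarrow> bool" where
  "spine_letter d y i \<longleftrightarrow> (\<exists>r. i = Suc r \<and> y r = 0 \<and> (\<forall>j<r. y j = d - 1))"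

lemma selector_first_letter: "selector first_letter"
  by (auto simp: selector_def first_letter_def)

text \<open>Since 0 and \<open>d - 1\<close> differ, \<open>r\<close> has to be the first position
  with a letter other than \<open>d - 1\<close>, so at most one letter is selected.\<close>

lemma selector_spine_letter:
  assumes "d \<ge> 2" shows "selector (spine_letter d)"
  unfolding selector_def
proof (intro conjI allI impI)
  show "spine_letter d y i = spine_letter d z i" if "\<forall>j<i. y j = z j" for y z i
  proof -
    have "y r = 0 \<and> (\<forall>j<r. y j = d - 1) \<longleftrightarrow> z r = 0 \<and> (\<forall>j<r. z j = d - 1)" if "i = Suc r" for r
      using \<open>\<forall>j<i. y j = z j\<close> that by simp
    then show ?thesis unfolding spine_letter_def by blast
  qed
  show "i = j" if ij: "spine_letter d y i" "spine_letter d y j" for y i j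
  proof -
    obtain r where r: "i = Suc r" "y r = 0" "\<forall>l<r. y l = d - 1"
      using ij(1) unfolding spine_letter_def by blast
    obtain s where s: "j = Suc s" "y s = 0" "\<forall>l<s. y l = d - 1"
      using ij(2) unfolding spine_letter_def by blast
    have "d - 1 \<noteq> 0" using assms by simp
    then have "\<not> r < s" "\<not> s < r" using r(2) s(2) r(3)[rule_format, of s] s(3)[rule_format, of r] by linarith+
    then show ?thesis using r(1) s(1) by simp
  qed
qed

lemma wadj_iff:
  "wadj d y z \<longleftrightarrow> (\<exists>j x. x < d \<and> z = y(j := x) \<and> (first_letter y j \<or> spine_letter d y j))"
  unfolding wadj_def first_letter_def spine_letter_def ..

lemma wadj_twist:
  assumes "d \<ge> 2" "y \<in> boundary d" "c = first_letter \<or> c = spine_letter d"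
  shows "wadj d y (boundary_act (twist d c \<kappa>) y)"
proof -
  have c: "selector c" using assms selector_first_letter selector_spine_letter by blast
  let ?z = "boundary_act (twist d c \<kappa>) y"
  have z: "?z i = (if c y i then (y i + \<kappa> i) mod d else y i)" for i
    by (rule boundary_act_twist[OF c assms(2)])
  show ?thesis
  proof (cases "\<exists>j. c y j")
    case True
    then obtain j where j: "c y j" by blast
    have "c y i \<longleftrightarrow> i = j" for i using j selector_unique[of c y i j] c by blast
    then have "?z = y(j := (y j + \<kappa> j) mod d)" by (simp add: z fun_eq_iff)
    moreover have "(y j + \<kappa> j) mod d < d" using assms(1) by simp
    ultimately show ?thesis using assms(3) j unfolding wadj_iff by blast
  next
    \<comment> \<open>A word without a selected letter is fixed, and the step is the trivial change
      of letter 0.\<close>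
    case False
    then have "?z = y(0 := y 0)" by (simp add: z fun_eq_iff)
    moreover have "first_letter y 0" by (simp add: first_letter_def)
    ultimately show ?thesis using boundary_less[OF assms(2)] unfolding wadj_iff by blast
  qed
qed

abbreviation rotation :: "nat \<Rightarrow> nat \<Rightarrow> tree_map" where
  "rotation d k \<equiv> twist d first_letter (\<lambda>_. k)"

lemma rotation_letter: "x < d \<Longrightarrow> rotation d k [x] = [(x + k) mod d]"
  by (simp add: twist_def first_letter_def)

lemma rooted_a_rotation: "rooted_a d = rotation d 1"
proof (rule extensionalityI[of _ "lists {..<d}"])
  fix u assume u: "u \<in> lists {..<d}"
  have len: "length (rooted_a d u) = length u" using u by (auto simp: rooted_a_def split: list.split)
  show "rooted_a d u = rotation d 1 u"
  proof (rule nth_equalityI)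
    show "length (rooted_a d u) = length (rotation d 1 u)" using len twist_length[OF u] by simp
    fix i assume "i < length (rooted_a d u)"
    then have i: "i < length u" using len by simp
    then show "rooted_a d u ! i = rotation d 1 u ! i"
      using u unfolding twist_nth[OF u i] rooted_a_def first_letter_def
      by (cases u; cases i) auto
  qed
qed (simp_all add: rooted_a_def twist_def)

text \<open>Natural shifts suffice, since the inverse of the shift by 1 is the shift by
  \<open>d - 1\<close>.\<close>

lemma carrier_group_A:
  assumes "d > 0" shows "carrier (group_A d) = range (rotation d)"
proof -
  let ?H = "generate (tree_aut d) {rooted_a d}"
  have "g \<in> range (rotation d)" if "g \<in> ?H" for g
    using that
  proof (induct rule: generate.induct)
    case one
    have "rotation d 0 = \<one>\<^bsub>tree_aut d\<^esub>" by (rule twist_one) simp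
    then show ?case by (metis rangeI)
  next
    case (incl h)
    then show ?case using rooted_a_rotation by auto
  next
    case (inv h)
    then have "inv\<^bsub>tree_aut d\<^esub> h = rotation d ((d - 1) * 1)"
      using twist_inv[OF assms selector_first_letter, of "\<lambda>_. 1"] rooted_a_rotation by simp
    then show ?case by blast
  next
    case (eng h1 h2)
    then show ?case by (auto simp: twist_mult[OF assms selector_first_letter])
  qed
  moreover have "rotation d k \<in> ?H" for k
  proof (induct k)
    case 0
    have "rotation d 0 = \<one>\<^bsub>tree_aut d\<^esub>" by (rule twist_one) simp
    then show ?case using generate.one by metis
  next
    case (Suc k)
    have "rotation d (Suc k) = rooted_a d \<otimes>\<^bsub>tree_aut d\<^esub> rotation d k"
      by (simp add: rooted_a_rotation twist_mult[OF assms selector_first_letter])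
    then show ?case using Suc by (auto intro: generate.eng generate.incl)
  qed
  ultimately show ?thesis by (auto simp: group_A_def)
qed

text \<open>The letter after \<open>(d - 1)\<^sup>r 0\<close> sits at \<open>i = Suc r\<close> and
  is moved by \<open>\<omega> r b\<close>, whence the index \<open>i - 1\<close>; position 0 is
  never a spine letter.\<close>

lemma spinal_elt_twist:
  assumes d: "d \<ge> 2" and \<kappa>: "\<And>r. \<omega> r b = rotation d (\<kappa> r)"
  shows "spinal_elt d \<omega> b = twist d (spine_letter d) (\<lambda>i. \<kappa> (i - 1))"
proof (rule extensionalityI[of _ "lists {..<d}"])
  fix u assume u: "u \<in> lists {..<d}"
  let ?r = "length (takeWhile (\<lambda>x. x = d - 1) u)"
  have spine: "spine_letter d (nth u) i \<longleftrightarrow> i = Suc ?r \<and> u ! ?r = 0" if i: "i < length u" for i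
  proof
    assume "spine_letter d (nth u) i"
    then obtain s where s: "i = Suc s" "u ! s = 0" "\<forall>j<s. u ! j = d - 1"
      unfolding spine_letter_def by blast
    \<comment> \<open>The run of letters \<open>d - 1\<close> stops exactly at \<open>s\<close>,
      where the letter is 0.\<close>
    have "takeWhile (\<lambda>x. x = d - 1) u = take s u"
      by (rule takeWhile_eq_take_P_nth) (use s d in auto)
    then have "?r = s" using s(1) i by simp
    then show "i = Suc ?r \<and> u ! ?r = 0" using s by simp
  next
    assume "i = Suc ?r \<and> u ! ?r = 0"
    moreover have "\<forall>j<?r. u ! j = d - 1" by (metis (mono_tags, lifting) nth_mem set_takeWhileD takeWhile_nth)
    ultimately show "spine_letter d (nth u) i" unfolding spine_letter_def by blast
  qed
  show "spinal_elt d \<omega> b u = twist d (spine_letter d) (\<lambda>i. \<kappa> (i - 1)) u"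
  proof (rule nth_equalityI)
    show len: "length (spinal_elt d \<omega> b u) = length (twist d (spine_letter d) (\<lambda>i. \<kappa> (i - 1)) u)"
      using u by (simp add: twist_length spinal_elt_def Let_def)
    fix i assume "i < length (spinal_elt d \<omega> b u)"
    then have i: "i < length u" using len twist_length[OF u] by simp
    show "spinal_elt d \<omega> b u ! i = twist d (spine_letter d) (\<lambda>i. \<kappa> (i - 1)) u ! i"
      unfolding twist_nth[OF u i] spine[OF i]
      using i u lists_nth_less[OF u]
      by (auto simp: spinal_elt_def Let_def nth_list_update \<kappa> rotation_letter)
  qed
qed (simp_all add: spinal_elt_def twist_def)

text \<open>Every generator is a twist, so arcs are \<open>wadj\<close> steps; surjectivity of each
  \<open>\<omega> r\<close> realises all \<open>wadj\<close> steps. Generators preserve cofinality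
  with \<open>\<xi>\<close>, and conversely \<open>wadj_reachable\<close> puts every cofinal word
  into the orbit.\<close>

lemma wadj_schreier_graph:
  assumes d: "d \<ge> 2" and \<omega>: "\<omega> \<in> Omega d m" and \<xi>: "\<xi> \<in> boundary d"
  defines "\<Gamma> \<equiv> schreier_graph (spinal_group d m \<omega>) (spinal_gens d m \<omega>) \<xi>"
  shows "adjacency \<Gamma> (wadj d)" "verts \<Gamma> = Cof d \<xi>"
proof -
  let ?S = "carrier (group_A d) \<union> group_B_omega d m \<omega>"
  let ?T = "tree_aut d"
  have d0: "d > 0" using d by simp
  note A = carrier_group_A[OF d0]
  have epi: "\<omega> r ` carrier (group_B d m) = range (rotation d)" for r
    using \<omega> unfolding Omega_def epi_def A[symmetric] by blast
  have B: "\<exists>\<kappa>. (\<forall>r. \<omega> r b = rotation d (\<kappa> r)) \<and> spinal_elt d \<omega> b = twist d (spine_letter d) (\<lambda>i. \<kappa> (i - 1))"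
    if "b \<in> carrier (group_B d m)" for b
  proof -
    have "\<forall>r. \<exists>k. \<omega> r b = rotation d k" using epi that by blast
    then obtain \<kappa> where "\<And>r. \<omega> r b = rotation d (\<kappa> r)" by metis
    then show ?thesis using spinal_elt_twist[OF d] by blast
  qed
  have S: "\<exists>c \<kappa>. s = twist d c \<kappa> \<and> (c = first_letter \<or> c = spine_letter d)" if "s \<in> ?S" for s
    using that B unfolding A group_B_omega_def by blast
  have sel: "selector c" if "c = first_letter \<or> c = spine_letter d" for c
    using that selector_first_letter selector_spine_letter[OF d] by blast
  have realise: "\<exists>s\<in>?S. boundary_act s y = z" if y: "y \<in> boundary d" and yz: "wadj d y z" for y z
  proof -
    obtain j x where j: "x < d" "z = y(j := x)" "first_letter y j \<or> spine_letter d y j"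
      using yz unfolding wadj_iff by blast
    have yj: "y j < d" using y by (rule boundary_less)
    \<comment> \<open>The shift \<open>x - y j\<close> modulo \<open>d\<close>, with
      \<open>d\<close> added first to stay within the natural numbers.\<close>
    let ?k = "x + d - y j"
    have k: "(y j + ?k) mod d = x" using yj j(1) by simp
    show ?thesis
    proof (cases "first_letter y j")
      case True
      have "boundary_act (rotation d ?k) y = z"
        using True k by (auto simp: boundary_act_twist[OF selector_first_letter y] j(2) first_letter_def)
      moreover have "rotation d ?k \<in> ?S" by (simp add: A)
      ultimately show ?thesis by blast
    next
      case False
      then have sp: "spine_letter d y j" using j(3) by blast
      have "rotation d ?k \<in> \<omega> (j - 1) ` carrier (group_B d m)" using epi by blast
      then obtain b where b: "b \<in> carrier (group_B d m)" "\<omega> (j - 1) b = rotation d ?k" by auto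
      obtain \<kappa> where \<kappa>: "\<And>r. \<omega> r b = rotation d (\<kappa> r)"
          "spinal_elt d \<omega> b = twist d (spine_letter d) (\<lambda>i. \<kappa> (i - 1))" using B[OF b(1)] by blast
      \<comment> \<open>The numbers \<open>\<kappa> (j - 1)\<close> and \<open>?k\<close> may
        differ; only the rotations coincide, and applying them to the one-letter word
        \<open>[y j]\<close> compares their effect on that letter.\<close>
      have "rotation d (\<kappa> (j - 1)) [y j] = rotation d ?k [y j]" using b(2) \<kappa>(1) by metis
      then have "(y j + \<kappa> (j - 1)) mod d = x" using k yj by (simp add: rotation_letter)
      moreover have "spine_letter d y i \<longleftrightarrow> i = j" for i
        using sp selector_unique[of "spine_letter d" y j i] selector_spine_letter[OF d] by blast
      ultimately have "boundary_act (spinal_elt d \<omega> b) y = z"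
        by (auto simp: \<kappa>(2) boundary_act_twist[OF selector_spine_letter[OF d] y] j(2))
      moreover have "spinal_elt d \<omega> b \<in> ?S" using b(1) by (simp add: group_B_omega_def)
      ultimately show ?thesis by blast
    qed
  qed
  have act_Cof: "z \<in> Cof d \<xi>" if y: "y \<in> Cof d \<xi>" and z: "z \<in> boundary d" and yz: "wadj d y z" for y z
  proof -
    obtain j x where j: "z = y(j := x)" using yz unfolding wadj_def by blast
    obtain N where "\<forall>i\<ge>N. y i = \<xi> i" using y Cof_iff by blast
    then have "\<forall>i\<ge>max N (Suc j). z i = \<xi> i" by (simp add: j)
    then show ?thesis using z Cof_iff by blast
  qed
  \<comment> \<open>The three properties go through the induction together: carrier membership turns
    the product into a composition, and \<open>level_map\<close> lets the composition act on
    infinite words.\<close>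
  have group: "g \<in> carrier ?T \<and> level_map d g \<and> (\<forall>y\<in>Cof d \<xi>. boundary_act g y \<in> Cof d \<xi>)"
    if "g \<in> spinal_group d m \<omega>" for g
  proof -
    have tw: "twist d c \<kappa> \<in> carrier ?T \<and> level_map d (twist d c \<kappa>) \<and>
        (\<forall>y\<in>Cof d \<xi>. boundary_act (twist d c \<kappa>) y \<in> Cof d \<xi>)"
      if c: "c = first_letter \<or> c = spine_letter d" for c \<kappa>
    proof (intro conjI ballI)
      show lm: "level_map d (twist d c \<kappa>)" using twist_level_map[OF sel[OF c]] .
      show "twist d c \<kappa> \<in> carrier ?T" using twist_in_tree_aut[OF d0 sel[OF c]] .
      fix y assume y: "y \<in> Cof d \<xi>"
      then have yb: "y \<in> boundary d" using Cof_iff by blast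
      show "boundary_act (twist d c \<kappa>) y \<in> Cof d \<xi>"
        using act_Cof[OF y boundary_act_boundary[OF lm yb] wadj_twist[OF d yb c]] .
    qed
    show ?thesis using that unfolding spinal_group_def
    proof (induct rule: generate.induct)
      case one
      have "rotation d 0 = \<one>\<^bsub>?T\<^esub>" by (rule twist_one) simp
      then show ?case using tw[of first_letter "\<lambda>_. 0"] by simp
    next
      case (incl h)
      then show ?case using S tw by blast
    next
      case (inv h)
      then obtain c \<kappa> where c: "h = twist d c \<kappa>" "c = first_letter \<or> c = spine_letter d" using S by blast
      \<comment> \<open>The inverse is a twist with the same selector, so \<open>tw\<close> covers
        it.\<close>
      show ?case using tw[OF c(2)] unfolding c(1) twist_inv[OF d0 sel[OF c(2)]] by blast
    next
      case (eng g h)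
      have eq: "g \<otimes>\<^bsub>?T\<^esub> h = compose (lists {..<d}) g h" using eng by (intro tree_aut_mult) auto
      have "g \<in> Bij (lists {..<d})" "h \<in> Bij (lists {..<d})" using eng by (auto simp: tree_aut_def)
      have "compose (lists {..<d}) g h \<in> carrier ?T"
      proof -
        have "compose (lists {..<d}) g h \<in> Bij (lists {..<d})" using \<open>g \<in> Bij _\<close> \<open>h \<in> Bij _\<close> by (rule compose_Bij)
        then show ?thesis using eng by (auto simp: tree_aut_def compose_def level_map_def)
      qed
      moreover have "level_map d (compose (lists {..<d}) g h)" using eng level_map_compose by blast
      moreover have "boundary_act (compose (lists {..<d}) g h) y \<in> Cof d \<xi>" if y: "y \<in> Cof d \<xi>" for y
      proof -
        have "y \<in> boundary d" using y Cof_iff by blast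
        then show ?thesis using boundary_act_compose[of d g h y] eng y by simp
      qed
      ultimately show ?case unfolding eq by blast
    qed
  qed
  have \<xi>C: "\<xi> \<in> Cof d \<xi>" using \<xi> by (simp add: Cof_iff)
  have orbit: "y \<in> (\<lambda>g. boundary_act g \<xi>) ` spinal_group d m \<omega>" if y: "y \<in> Cof d \<xi>" for y
  proof -
    obtain N where N: "\<forall>i\<ge>N. y i = \<xi> i" and yb: "y \<in> boundary d" using y Cof_iff by blast
    have "(\<xi>, y) \<in> rtrancl_on (Cof d \<xi>) {(a, b). wadj d a b}"
      using wadj_reachable[OF d \<xi>C yb, of N] N by simp
    then show ?thesis
    proof (induct rule: rtrancl_on_induct)
      case base
      have one: "\<one>\<^bsub>?T\<^esub> \<in> spinal_group d m \<omega>" unfolding spinal_group_def by (rule generate.one)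
      show ?case using boundary_act_one[OF \<xi>] imageI[OF one, of "\<lambda>g. boundary_act g \<xi>"] by simp
    next
      case (step y z)
      then obtain g where g: "g \<in> spinal_group d m \<omega>" "y = boundary_act g \<xi>" by blast
      have "y \<in> boundary d" using step Cof_iff by blast
      then obtain s where s: "s \<in> ?S" "boundary_act s y = z" using realise step by blast
      then have sG: "s \<in> spinal_group d m \<omega>" unfolding spinal_group_def by (rule_tac generate.incl)
      have "s \<otimes>\<^bsub>?T\<^esub> g \<in> spinal_group d m \<omega>"
        using sG g(1) unfolding spinal_group_def by (rule generate.eng)
      moreover have "boundary_act (s \<otimes>\<^bsub>?T\<^esub> g) \<xi> = z"
        using group[OF sG] group[OF g(1)] boundary_act_compose[of d s g \<xi>] \<xi> s(2) g(2)
        by (simp add: tree_aut_mult)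
      ultimately show ?case by blast
    qed
  qed
  have verts: "verts \<Gamma> = (\<lambda>g. boundary_act g \<xi>) ` spinal_group d m \<omega>"
    and arcs: "arcs \<Gamma> = verts \<Gamma> \<times> spinal_gens d m \<omega>"
    and tail: "tail \<Gamma> = fst" and head: "head \<Gamma> = (\<lambda>(y, s). boundary_act s y)"
    by (simp_all add: \<Gamma>_def schreier_graph_def Let_def)
  show V: "verts \<Gamma> = Cof d \<xi>"
    using orbit group \<xi>C unfolding verts by blast
  show "adjacency \<Gamma> (wadj d)"
  proof
    fix e assume "e \<in> arcs \<Gamma>"
    then obtain y s where e: "e = (y, s)" "y \<in> Cof d \<xi>" "s \<in> ?S"
      unfolding arcs V spinal_gens_def by blast
    obtain c \<kappa> where c: "s = twist d c \<kappa>" "c = first_letter \<or> c = spine_letter d" using S e(3) by blast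
    have "y \<in> boundary d" using e(2) Cof_iff by blast
    then show "wadj d (tail \<Gamma> e) (head \<Gamma> e)"
      using wadj_twist[OF d _ c(2)] c(1) e(1) by (simp add: tail head)
  next
    fix y z assume yz: "y \<in> verts \<Gamma>" "z \<in> verts \<Gamma>" "wadj d y z"
    then have y: "y \<in> boundary d" using V Cof_iff by blast
    show "wadj d z y" using wadj_sym[OF yz(3) y] .
    assume "y \<noteq> z"
    obtain s where s: "s \<in> ?S" "boundary_act s y = z" using realise[OF y yz(3)] by blast
    \<comment> \<open>A step between distinct words is not made by the identity, the only element
      removed from the generators.\<close>
    have "s \<in> spinal_gens d m \<omega>" using s \<open>y \<noteq> z\<close> boundary_act_one[OF y] by (auto simp: spinal_gens_def)
    then show "\<exists>e\<in>arcs \<Gamma>. tail \<Gamma> e = y \<and> head \<Gamma> e = z"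
      using yz(1) s(2) by (intro bexI[of _ "(y, s)"]) (simp_all add: arcs tail head)
  qed
qed

theorem theorem6p1:
  fixes d m :: nat
    and \<omega> :: "nat \<Rightarrow> (nat \<Rightarrow> int) \<Rightarrow> tree_map"
    and \<xi> :: "nat word"
  assumes "d \<ge> 2" and "m \<ge> 1" and "\<omega> \<in> Omega d m" and "\<xi> \<in> boundary d"
  shows "(ended 2 (schreier_graph (spinal_group d m \<omega>) (spinal_gens d m \<omega>) \<xi>) \<longleftrightarrow> \<xi> \<in> E2 d) \<and>
         (ended 1 (schreier_graph (spinal_group d m \<omega>) (spinal_gens d m \<omega>) \<xi>) \<longleftrightarrow> \<xi> \<in> E1 d)"
  using ended_iff_cofinality_graph[OF assms(1,4) wadj_schreier_graph[OF assms(1,3,4)]] .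

end
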